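(* Let $k$ be a field, let $n\ge 1$, and let $\mathcal{NC}_n$ be the Nilcoxeter algebra over $k$. Then the dimension over $k$ of the center of $\mathcal{NC}_n$ is $$\dim_k Z(\mathcal{NC}_n)=\sum_{\lambda\vdash n}\frac{n_\lambda!}{m_\lambda},$$ where the sum runs over all partitions $\lambda$ of $n$, $n_\lambda$ is the number of even parts of $\lambda$ (counted with multiplicity), and $m_\lambda=\prod_{j\ge 1} i_j!$ with $i_j=i_j(\lambda)$ the number of parts of $\lambda$ equal to $2j$.
   Context: The Nilcoxeter algebra $\mathcal{NC}_n$ is the unital associative $k$-algebra generated by $T_1,\dots,T_{n-1}$ with relations $T_iT_{i+1}T_i=T_{i+1}T_iT_{i+1}$, $T_iT_j=T_jT_i$ for $|i-j|>1$, and $T_i^2=0$. It has a $k$-basis $\{T_w\}_{w\in S_n}$, where $T_w=T_{i_1}\cdots T_{i_l}$ for any reduced expression $w=s_{i_1}\cdots s_{i_l}$, $s_i=(i\;\,i+1)$. $Z(\cdot)$ denotes the center. *)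

theory Defs
  imports "HOL-Algebra.Embedded_Algebras" "HOL-Algebra.QuotRing"
    "HOL-Library.Poly_Mapping" "HOL-Library.Multiset"
begin

text \<open>
  The free monoid on a type of letters, written additively because the convolution product of
  finitely supported functions (theory \<open>Poly_Mapping\<close>) is defined over an additive monoid.
  With \<open>X\<close> a set of letters, noncommutative polynomials in the letters of \<open>X\<close> are the
  finitely supported functions from words to \<open>k\<close> whose support consists of words over \<open>X\<close>.
\<close>

datatype 'a free_word = Word (letters: "'a list")

instantiation free_word :: (type) monoid_add
begin

definition zero_free_word :: "'a free_word"
  where "0 = Word []"

definition plus_free_word :: "'a free_word \<Rightarrow> 'a free_word \<Rightarrow> 'a free_word"
  where "u + v = Word (letters u @ letters v)"

instance
  by standard (simp_all add: zero_free_word_def plus_free_word_def)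

end

definition free_algebra :: "'a set \<Rightarrow> ('a free_word \<Rightarrow>\<^sub>0 'k::field) ring"
  where "free_algebra X =
    \<lparr>carrier = {f. \<forall>w\<in>Poly_Mapping.keys f. set (letters w) \<subseteq> X},
     monoid.mult = (*), one = 1, zero = 0, add = (+)\<rparr>"

lemma free_algebra_ring: "ring (free_algebra X :: ('a free_word \<Rightarrow>\<^sub>0 'k::field) ring)"
proof (rule ringI)
  show "abelian_group (free_algebra X :: ('a free_word \<Rightarrow>\<^sub>0 'k) ring)"
  proof (rule abelian_groupI)
    fix x y :: "'a free_word \<Rightarrow>\<^sub>0 'k"
    assume x: "x \<in> carrier (free_algebra X)"
    show "\<exists>y\<in>carrier (free_algebra X). y \<oplus>\<^bsub>free_algebra X\<^esub> x = \<zero>\<^bsub>free_algebra X\<^esub>"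
      using x by (intro bexI[of _ "- x"]) (auto simp: free_algebra_def)
    assume y: "y \<in> carrier (free_algebra X)"
    show "x \<oplus>\<^bsub>free_algebra X\<^esub> y \<in> carrier (free_algebra X)"
      using x y keys_add[of x y] by (fastforce simp: free_algebra_def)
  qed (auto simp: free_algebra_def algebra_simps)
  show "Group.monoid (free_algebra X :: ('a free_word \<Rightarrow>\<^sub>0 'k) ring)"
  proof (rule Group.monoidI)
    fix x y :: "'a free_word \<Rightarrow>\<^sub>0 'k"
    assume "x \<in> carrier (free_algebra X)" "y \<in> carrier (free_algebra X)"
    then show "x \<otimes>\<^bsub>free_algebra X\<^esub> y \<in> carrier (free_algebra X)"
      using keys_mult[of x y] by (fastforce simp: free_algebra_def plus_free_word_def)
  qed (auto simp: free_algebra_def zero_free_word_def algebra_simps)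
qed (auto simp: free_algebra_def algebra_simps)

definition gen :: "'a \<Rightarrow> 'a free_word \<Rightarrow>\<^sub>0 'k::field"
  where "gen i = Poly_Mapping.single (Word [i]) 1"

definition nilcoxeter_relators :: "nat \<Rightarrow> (nat free_word \<Rightarrow>\<^sub>0 'k::field) set"
  where "nilcoxeter_relators n =
    {gen i * gen (i + 1) * gen i - gen (i + 1) * gen i * gen (i + 1) | i.
       i \<in> {1..<n} \<and> i + 1 \<in> {1..<n}}
    \<union> {gen i * gen j - gen j * gen i | i j.
       i \<in> {1..<n} \<and> j \<in> {1..<n} \<and> \<bar>int i - int j\<bar> > 1}
    \<union> {gen i * gen i | i. i \<in> {1..<n}}"

definition nilcoxeter_ideal :: "nat \<Rightarrow> (nat free_word \<Rightarrow>\<^sub>0 'k::field) set"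
  where "nilcoxeter_ideal n = genideal (free_algebra {1..<n}) (nilcoxeter_relators n)"

definition nilcoxeter :: "nat \<Rightarrow> (nat free_word \<Rightarrow>\<^sub>0 'k::field) set ring"
  where "nilcoxeter n = free_algebra {1..<n} Quot nilcoxeter_ideal n"

text \<open>
  The copy \<open>k \<cdot> 1\<close> of the ground field inside the algebra. Scalar multiplication by \<open>c\<close> is
  multiplication by \<open>c \<cdot> 1\<close>, so a dimension over \<open>k\<close> is a dimension over this subfield in the
  sense of \<open>ring.dimension\<close>.
\<close>

definition nilcoxeter_scalars :: "nat \<Rightarrow> (nat free_word \<Rightarrow>\<^sub>0 'k::field) set set"
  where "nilcoxeter_scalars n =
    range (\<lambda>c. nilcoxeter_ideal n +>\<^bsub>free_algebra {1..<n}\<^esub> Poly_Mapping.single 0 c)"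

lemma nilcoxeter_relators_closed:
  "nilcoxeter_relators n \<subseteq> carrier (free_algebra {1..<n} :: (nat free_word \<Rightarrow>\<^sub>0 'k::field) ring)"
  by (auto simp: nilcoxeter_relators_def gen_def mult_single plus_free_word_def free_algebra_def
      dest!: subsetD[OF keys_diff] split: if_splits)

lemma nilcoxeter_ideal_ideal:
  "ideal (nilcoxeter_ideal n) (free_algebra {1..<n} :: (nat free_word \<Rightarrow>\<^sub>0 'k::field) ring)"
  unfolding nilcoxeter_ideal_def
  by (rule ring.genideal_ideal[OF free_algebra_ring nilcoxeter_relators_closed])

lemma nilcoxeter_ring: "ring (nilcoxeter n :: (nat free_word \<Rightarrow>\<^sub>0 'k::field) set ring)"
  unfolding nilcoxeter_def by (rule ideal.quotient_is_ring[OF nilcoxeter_ideal_ideal])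

text \<open>
  Adequacy: constant terms of elements of the ideal vanish, so the quotient is nonzero and
  the scalars really form a subfield, as \<open>ring.dimension\<close> presupposes.
\<close>

lemma letters_zero: "letters 0 = []"
  by (simp add: zero_free_word_def)

lemma lookup_mult_zero_free_word:
  fixes f g :: "'a free_word \<Rightarrow>\<^sub>0 'k::field"
  shows "Poly_Mapping.lookup (f * g) 0 = Poly_Mapping.lookup f 0 * Poly_Mapping.lookup g 0"
proof -
  have eq: "0 = l + q \<longleftrightarrow> q = 0 \<and> l = 0" for l q :: "'a free_word"
    by (cases l; cases q) (auto simp: zero_free_word_def plus_free_word_def)
  have "(\<Sum>q. Poly_Mapping.lookup g q when 0 = l + q) = (Poly_Mapping.lookup g 0 when l = 0)"
    for l :: "'a free_word"
    by (cases "l = 0") (simp_all add: eq)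
  then show ?thesis
    by (simp add: lookup_mult mult_when)
qed

lemma lookup_gen_zero: "Poly_Mapping.lookup (gen i) 0 = 0"
  by (simp add: gen_def lookup_single zero_free_word_def)

lemma lookup_nilcoxeter_ideal:
  fixes f :: "nat free_word \<Rightarrow>\<^sub>0 'k::field"
  assumes "f \<in> nilcoxeter_ideal n"
  shows "Poly_Mapping.lookup f 0 = 0"
proof -
  let ?A = "free_algebra {1..<n} :: (nat free_word \<Rightarrow>\<^sub>0 'k) ring"
  let ?J = "{f \<in> carrier ?A. Poly_Mapping.lookup f 0 = 0}"
  interpret A: ring ?A by (rule free_algebra_ring)
  have minus: "\<ominus>\<^bsub>?A\<^esub> x = - x" if "x \<in> carrier ?A" for x
    using that by (intro A.minus_equality) (auto simp: free_algebra_def)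
  have "ideal ?J ?A"
  proof (rule idealI)
    show "subgroup ?J (add_monoid ?A)"
    proof (rule A.add.subgroupI)
      show "?J \<noteq> {}" by (auto intro!: exI[of _ 0] simp: free_algebra_def)
      fix a assume a: "a \<in> ?J"
      then show "\<ominus>\<^bsub>?A\<^esub> a \<in> ?J"
        using A.a_inv_closed[of a] minus[of a] by auto
      fix b assume b: "b \<in> ?J"
      show "a \<oplus>\<^bsub>?A\<^esub> b \<in> ?J"
        using a b A.a_closed[of a b] by (auto simp: free_algebra_def lookup_add)
    qed auto
  next
    fix a x assume "a \<in> ?J" "x \<in> carrier ?A"
    then show "x \<otimes>\<^bsub>?A\<^esub> a \<in> ?J" "a \<otimes>\<^bsub>?A\<^esub> x \<in> ?J"
      using A.m_closed[of a x] A.m_closed[of x a]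
      by (auto simp: free_algebra_def lookup_mult_zero_free_word)
  qed (rule A.ring_axioms)
  moreover have "Poly_Mapping.lookup r 0 = 0" if "r \<in> nilcoxeter_relators n"
    for r :: "nat free_word \<Rightarrow>\<^sub>0 'k"
    using that by (auto simp: nilcoxeter_relators_def lookup_minus
        lookup_mult_zero_free_word lookup_gen_zero)
  then have "nilcoxeter_relators n \<subseteq> ?J"
    using nilcoxeter_relators_closed by blast
  ultimately have "nilcoxeter_ideal n \<subseteq> ?J"
    unfolding nilcoxeter_ideal_def by (rule A.genideal_minimal)
  then show ?thesis using assms by blast
qed

lemma nilcoxeter_scalars_subfield:
  "subfield (nilcoxeter_scalars n) (nilcoxeter n :: (nat free_word \<Rightarrow>\<^sub>0 'k::field) set ring)"
proof -
  let ?A = "free_algebra {1..<n} :: (nat free_word \<Rightarrow>\<^sub>0 'k) ring"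
  let ?N = "nilcoxeter n :: (nat free_word \<Rightarrow>\<^sub>0 'k) set ring"
  let ?k = "\<lparr>carrier = UNIV :: 'k set, monoid.mult = (*), one = 1, zero = 0, add = (+)\<rparr>"
  let ?I = "nilcoxeter_ideal n :: (nat free_word \<Rightarrow>\<^sub>0 'k) set"
  let ?h = "\<lambda>c. ?I +>\<^bsub>?A\<^esub> Poly_Mapping.single 0 c"
  interpret I: ideal ?I ?A by (rule nilcoxeter_ideal_ideal)
  interpret N: ring ?N by (rule nilcoxeter_ring)
  have "cring ?k"
  proof (rule cringI)
    show "abelian_group ?k"
      by (rule abelian_groupI) (auto intro: exI[of _ "- x" for x] simp: algebra_simps)
    show "comm_monoid ?k"
      by (rule comm_monoidI) (auto simp: algebra_simps)
  qed (simp add: algebra_simps)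
  then have field: "field ?k"
  proof (rule cring.cring_fieldI2)
    fix a :: 'k assume "a \<noteq> \<zero>\<^bsub>?k\<^esub>"
    then show "\<exists>b\<in>carrier ?k. a \<otimes>\<^bsub>?k\<^esub> b = \<one>\<^bsub>?k\<^esub>"
      by (intro bexI[of _ "inverse a"]) auto
  qed simp
  interpret K: field ?k by (rule field)
  have single: "(\<lambda>c. Poly_Mapping.single 0 c) \<in> ring_hom ?k ?A"
    by (rule ring_hom_memI)
      (auto simp: free_algebra_def mult_single single_add letters_zero)
  have "ring_hom_ring ?k ?N ?h"
  proof (rule ring_hom_ringI2)
    show "?h \<in> ring_hom ?k ?N"
      using ring_hom_trans[OF single I.rcos_ring_hom] by (simp add: nilcoxeter_def comp_def)
  qed (rule K.ring_axioms N.ring_axioms)+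
  moreover have "\<one>\<^bsub>?N\<^esub> \<noteq> \<zero>\<^bsub>?N\<^esub>"
  proof
    assume "\<one>\<^bsub>?N\<^esub> = \<zero>\<^bsub>?N\<^esub>"
    then have "?I +>\<^bsub>?A\<^esub> \<one>\<^bsub>?A\<^esub> = ?I" by (simp add: nilcoxeter_def FactRing_def)
    then have "\<one>\<^bsub>?A\<^esub> \<in> ?I" by (metis I.a_rcos_self I.one_closed)
    then show False
      using lookup_nilcoxeter_ideal[of "1 :: nat free_word \<Rightarrow>\<^sub>0 'k" n]
      by (simp add: free_algebra_def lookup_one)
  qed
  ultimately have "subfield (?h ` UNIV) ?N"
    using ring_hom_ring.img_is_subfield(2)[OF _ K.carrier_is_subfield] by auto
  then show ?thesis by (simp add: nilcoxeter_scalars_def)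
qed

definition ring_center :: "('a, 'b) ring_scheme \<Rightarrow> 'a set"
  where "ring_center R =
    {z \<in> carrier R. \<forall>x\<in>carrier R. z \<otimes>\<^bsub>R\<^esub> x = x \<otimes>\<^bsub>R\<^esub> z}"

definition partitions :: "nat \<Rightarrow> nat multiset set"
  where "partitions n = {p. 0 \<notin># p \<and> sum_mset p = n}"

text \<open>
  A sum over an infinite set is \<open>0\<close> by convention, so finiteness of the index set matters.
\<close>

lemma finite_partitions: "finite (partitions n)"
proof (rule finite_subset)
  show "partitions n \<subseteq> mset ` {xs. set xs \<subseteq> {..n} \<and> length xs \<le> n}"
  proof
    fix p assume p: "p \<in> partitions n"
    obtain xs where xs: "p = mset xs" by (metis ex_mset)
    have "length xs \<le> sum_list xs" if "0 \<notin> set xs" for xs :: "nat list"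
      using that by (induction xs) auto
    moreover have "x \<le> sum_list xs" if "x \<in> set xs" for x
      using that by (intro member_le_sum_list) auto
    ultimately show "p \<in> mset ` {xs. set xs \<subseteq> {..n} \<and> length xs \<le> n}"
      using p xs by (auto simp: partitions_def sum_mset_sum_list)
  qed
qed (simp add: finite_lists_length_le)

definition num_even_parts :: "nat multiset \<Rightarrow> nat"
  where "num_even_parts p = size (filter_mset even p)"

text \<open>
  The product over all \<open>j \<ge> 1\<close>, restricted to its finitely many factors with \<open>2 j\<close> a part;
  the remaining factors are \<open>0! = 1\<close>.
\<close>

definition even_mult_fact :: "nat multiset \<Rightarrow> nat"
  where "even_mult_fact p = (\<Prod>j | j \<ge> 1 \<and> 2 * j \<in># p. fact (count p (2 * j)))"

end

theory Submission
  imports Defs "HOL-Combinatorics.Cycles" "HOL-Combinatorics.Multiset_Permutations"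
begin

text \<open>
  Comparing the coefficients of \<open>T\<^sub>i z\<close> and \<open>z T\<^sub>i\<close>, an element \<open>z\<close> with coefficients
  \<open>c\<^sub>w\<close> is central iff, whenever one of \<open>s\<^sub>i w\<close>, \<open>w s\<^sub>i\<close> is longer than \<open>w\<close>,
  \<open>c\<close> agrees on \<open>w\<close> and \<open>s\<^sub>i w s\<^sub>i\<close> if these have equal length, and \<open>c\<^sub>w = 0\<close> otherwise.
  So the center has a basis indexed by the classes under such conjugation steps from which no
  step increases the length.

  By relabelling, every permutation reaches a canonical one by steps: nested cycles
  \<open>1 \<rightarrow> n \<rightarrow> 2 \<rightarrow> n - 1 \<rightarrow> \<dots>\<close> whose lengths are first even numbers in any order and then
  odd numbers in descending order. Conversely a canonical permutation that reaches a canonical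
  permutation is equal to it: steps preserve the cycle type, and they preserve the fact that the
  first \<open>k\<close> and the last \<open>k\<close> points are exchanged, which determines the order of the even
  cycles. Hence no step out of the class of a canonical permutation increases the length. Arranging
  the even parts of \<open>\<lambda>\<close> in all orders gives the summand \<open>n\<^sub>\<lambda>! / m\<^sub>\<lambda>\<close>.
\<close>

unbundle no m_inv_syntax

section \<open>Sorting the labels of cycles\<close>

text \<open>A lengthening step cannot be undone, so the set of \<open>k\<close> whose end blocks are
  exchanged is only known to grow along steps. Between two canonical permutations this gives an
  inclusion, and counting turns it into an equality: the set has one element more than there are
  even cycles, a number fixed by the cycle type. Odd cycles leave no trace in this set. The last
  entry of an odd cycle and its image both lie on the low side, and this lets even cycles and longer
  cycles pass outwards; hence odd cycles end up innermost and sorted. Comparing coefficients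
  presupposes that the \<open>T_w\<close> form a basis of the algebra given by generators and
  relations. This is derived here: a functional that reads off the reduced words of \<open>w\<close>
  vanishes on the ideal, which gives independence, and Matsumoto's theorem gives spanning.\<close>

fun before :: "'a list \<Rightarrow> 'a \<Rightarrow> 'a \<Rightarrow> bool" where
  "before [] u v \<longleftrightarrow> False"
| "before (x # xs) u v \<longleftrightarrow> (u = x \<and> v \<in> set xs) \<or> before xs u v"

lemma before_append:
  "before (xs @ ys) u v \<longleftrightarrow> before xs u v \<or> before ys u v \<or> (u \<in> set xs \<and> v \<in> set ys)"
  by (induction xs) auto

text \<open>
  The list \<open>L\<close> records which element carries which label, and \<open>\<sigma>\<close> is the permutation of the
  elements. Exchanging two adjacent labels conjugates the permutation of the labels by a simple
  transposition; the side condition says that this does not decrease the length.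
\<close>

inductive swap_step :: "('a \<Rightarrow> 'a) \<Rightarrow> 'a list \<Rightarrow> 'a list \<Rightarrow> bool" for \<sigma>
  where "before (xs @ a # b # ys) (\<sigma> a) (\<sigma> b) \<or> before (xs @ a # b # ys) (inv \<sigma> a) (inv \<sigma> b)
    \<Longrightarrow> swap_step \<sigma> (xs @ a # b # ys) (xs @ b # a # ys)"

lemma swap_step_mset: "swap_step \<sigma> L L' \<Longrightarrow> mset L' = mset L"
  by (auto elim: swap_step.cases)

lemma swap_steps_mset: "(swap_step \<sigma>)\<^sup>*\<^sup>* L L' \<Longrightarrow> mset L' = mset L"
  by (induction rule: rtranclp_induct) (auto dest: swap_step_mset)

text \<open>Enlarging a list keeps every \<open>before\<close> relation. Inner cycles can therefore
  be rearranged without touching the outer ones, which makes the sorting recursive.\<close>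

lemma swap_step_context:
  assumes "swap_step \<sigma> L L'"
  shows "swap_step \<sigma> (P @ L @ Q) (P @ L' @ Q)"
  using assms
proof cases
  case (1 xs a b ys)
  have "before (P @ L @ Q) u v" if "before L u v" for u v
    using that by (simp add: before_append)
  then show ?thesis
    using 1 swap_step.intros[of "P @ xs" a b "ys @ Q" \<sigma>] by (metis append.assoc append_Cons)
qed

lemma swap_steps_context:
  assumes "(swap_step \<sigma>)\<^sup>*\<^sup>* L L'"
  shows "(swap_step \<sigma>)\<^sup>*\<^sup>* (P @ L @ Q) (P @ L' @ Q)"
  using assms
  by (induction rule: rtranclp_induct) (auto intro: rtranclp.rtrancl_into_rtrancl swap_step_context)

text \<open>The side condition is demanded at each intermediate arrangement, where \<open>a\<close>
  has passed \<open>B1\<close> and stands directly before \<open>e\<close>, because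
  \<open>before\<close> is read off the current list.\<close>

lemma swap_steps_right:
  assumes "\<And>B1 e B2. B = B1 @ e # B2 \<Longrightarrow>
      before (xs @ B1 @ a # e # B2 @ ys) (\<sigma> a) (\<sigma> e) \<or>
      before (xs @ B1 @ a # e # B2 @ ys) (inv \<sigma> a) (inv \<sigma> e)"
  shows "(swap_step \<sigma>)\<^sup>*\<^sup>* (xs @ a # B @ ys) (xs @ B @ a # ys)"
  using assms
proof (induction B arbitrary: xs)
  case (Cons e B)
  have "swap_step \<sigma> (xs @ a # (e # B) @ ys) ((xs @ [e]) @ a # B @ ys)"
    using Cons.prems[of "[]" e B] swap_step.intros[of xs a e "B @ ys" \<sigma>] by simp
  moreover have "(swap_step \<sigma>)\<^sup>*\<^sup>* ((xs @ [e]) @ a # B @ ys) ((xs @ [e]) @ B @ a # ys)"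
  proof (rule Cons.IH)
    fix B1 e' B2 assume "B = B1 @ e' # B2"
    then show "before ((xs @ [e]) @ B1 @ a # e' # B2 @ ys) (\<sigma> a) (\<sigma> e') \<or>
      before ((xs @ [e]) @ B1 @ a # e' # B2 @ ys) (inv \<sigma> a) (inv \<sigma> e')"
      using Cons.prems[of "e # B1" e' B2] by simp
  qed
  ultimately show ?case by simp
qed simp

lemma swap_steps_left:
  assumes "\<And>B1 e B2. B = B1 @ e # B2 \<Longrightarrow>
      before (xs @ B1 @ e # a # B2 @ ys) (\<sigma> e) (\<sigma> a) \<or>
      before (xs @ B1 @ e # a # B2 @ ys) (inv \<sigma> e) (inv \<sigma> a)"
  shows "(swap_step \<sigma>)\<^sup>*\<^sup>* (xs @ B @ a # ys) (xs @ a # B @ ys)"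
  using assms
proof (induction B arbitrary: ys rule: rev_induct)
  case (snoc e B)
  have "swap_step \<sigma> (xs @ (B @ [e]) @ a # ys) (xs @ B @ a # e # ys)"
    using snoc.prems[of B e "[]"] swap_step.intros[of "xs @ B" e a ys \<sigma>] by simp
  moreover have "(swap_step \<sigma>)\<^sup>*\<^sup>* (xs @ B @ a # e # ys) (xs @ a # B @ e # ys)"
  proof (rule snoc.IH)
    fix B1 e' B2 assume "B = B1 @ e' # B2"
    then show "before (xs @ B1 @ e' # a # B2 @ e # ys) (\<sigma> e') (\<sigma> a) \<or>
      before (xs @ B1 @ e' # a # B2 @ e # ys) (inv \<sigma> e') (inv \<sigma> a)"
      using snoc.prems[of B1 e' "B2 @ [e]"] by simp
  qed
  ultimately show ?case by simp
qed simp

text \<open>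
  \<open>wrap cs M\<close> lists the entries of \<open>cs\<close> alternately from the outside at the low and at the high
  end, around \<open>M\<close>.
\<close>

fun lows :: "'a list \<Rightarrow> 'a list" where
  "lows [] = []"
| "lows [c] = [c]"
| "lows (c # d # cs) = c # lows cs"

definition highs :: "'a list \<Rightarrow> 'a list"
  where "highs cs = lows (tl cs)"

definition wrap :: "'a list \<Rightarrow> 'a list \<Rightarrow> 'a list"
  where "wrap cs M = lows cs @ M @ rev (highs cs)"

lemma lows_Cons: "lows (c # cs) = c # highs cs"
  by (cases cs) (auto simp: highs_def)

lemma highs_Cons: "highs (c # cs) = lows cs"
  by (simp add: highs_def)

lemma highs_Nil [simp]: "highs [] = []"
  by (simp add: highs_def)

lemma lows_highs_snoc:
  "lows (cs @ [c]) = (if even (length cs) then lows cs @ [c] else lows cs)"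
  "highs (cs @ [c]) = (if even (length cs) then highs cs else highs cs @ [c])"
  by (induction cs) (auto simp: lows_Cons highs_Cons)

lemma wrap_Nil [simp]: "wrap [] M = M"
  by (simp add: wrap_def)

text \<open>The last entry of \<open>cs\<close> is the innermost one, so cycles are built up and
  taken apart from the inside: one more entry goes to one end of the middle part.\<close>

lemma wrap_snoc:
  "wrap (cs @ [c]) M = wrap cs (if even (length cs) then c # M else M @ [c])"
  by (simp add: wrap_def lows_highs_snoc)

lemma mset_lows_highs: "mset (lows cs) + mset (highs cs) = mset cs"
  by (induction cs) (simp_all add: lows_Cons highs_Cons add.commute)

lemma mset_wrap: "mset (wrap cs M) = mset cs + mset M"
  using mset_lows_highs[of cs] by (simp add: wrap_def add.assoc add.commute add.left_commute)

lemma set_wrap: "set (wrap cs M) = set cs \<union> set M"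
  using mset_wrap[of cs M] by (metis set_mset_mset set_mset_union)

lemma set_lows_highs: "set cs = set (lows cs) \<union> set (highs cs)"
  using set_wrap[of cs "[]"] by (simp add: wrap_def)

lemma length_wrap: "length (wrap cs M) = length cs + length M"
  using mset_wrap[of cs M] by (metis size_mset size_union)

lemma distinct_wrap: "distinct (wrap cs M) \<longleftrightarrow> distinct cs \<and> distinct M \<and> set cs \<inter> set M = {}"
  using mset_wrap[of cs M] by (metis distinct_append mset_append mset_eq_imp_distinct_iff)

lemma set_lows: "x \<in> set (lows cs) \<longleftrightarrow> (\<exists>i<length cs. even i \<and> cs ! i = x)"
  and set_highs: "x \<in> set (highs cs) \<longleftrightarrow> (\<exists>i<length cs. odd i \<and> cs ! i = x)"
proof (induction cs)
  case (Cons c cs)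
  have *: "(\<exists>i<Suc n. P i) \<longleftrightarrow> P 0 \<or> (\<exists>i<n. P (Suc i))" for P n
    using less_Suc_eq_0_disj by auto
  case 1 show ?case using Cons by (simp add: lows_Cons * eq_commute)
  case 2 show ?case using Cons by (simp add: highs_Cons *)
qed simp_all

lemma swap_steps_wrap:
  "(swap_step \<sigma>)\<^sup>*\<^sup>* M M' \<Longrightarrow> (swap_step \<sigma>)\<^sup>*\<^sup>* (wrap cs M) (wrap cs M')"
  unfolding wrap_def by (rule swap_steps_context)

section \<open>Cycles as lists of points\<close>

definition is_cycle :: "('a \<Rightarrow> 'a) \<Rightarrow> 'a list \<Rightarrow> bool"
  where "is_cycle \<sigma> cs \<longleftrightarrow> cs \<noteq> [] \<and> distinct cs \<and> map \<sigma> cs = rotate1 cs"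

lemma is_cycle_nth:
  assumes "is_cycle \<sigma> cs" "i < length cs"
  shows "\<sigma> (cs ! i) = cs ! (Suc i mod length cs)"
  using assms by (metis is_cycle_def nth_map nth_rotate1)

lemma is_cycle_Suc:
  assumes "is_cycle \<sigma> cs" "Suc i < length cs"
  shows "\<sigma> (cs ! i) = cs ! Suc i"
  using is_cycle_nth[OF assms(1), of i] assms(2) by simp

lemma is_cycle_last:
  assumes "is_cycle \<sigma> cs" "Suc i = length cs"
  shows "\<sigma> (cs ! i) = cs ! 0"
  using is_cycle_nth[OF assms(1), of i] assms(2) by simp

lemma is_cycle_image: "is_cycle \<sigma> cs \<Longrightarrow> \<sigma> ` set cs = set cs"
  by (metis is_cycle_def list.set_map set_rotate1)

lemma is_cycle_support:
  assumes "permutation \<sigma>"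
  shows "is_cycle \<sigma> (support \<sigma> a)"
proof -
  let ?p = "least_power \<sigma> a"
  have p: "?p > 0" "(\<sigma> ^^ ?p) a = a"
    using least_power_of_permutation[OF assms] by auto
  have "map \<sigma> (support \<sigma> a) = rotate1 (support \<sigma> a)"
  proof (rule nth_equalityI)
    fix i assume "i < length (map \<sigma> (support \<sigma> a))"
    then have i: "i < ?p" by simp
    have "(\<sigma> ^^ Suc i) a = (\<sigma> ^^ (Suc i mod ?p)) a"
      using i p by (cases "Suc i = ?p") auto
    then show "map \<sigma> (support \<sigma> a) ! i = rotate1 (support \<sigma> a) ! i"
      using i p by (simp add: nth_rotate1)
  qed simp
  then show ?thesis
    using cycle_of_permutation[OF assms, of a] p by (simp add: is_cycle_def)
qed

lemma hd_support: "permutation \<sigma> \<Longrightarrow> hd (support \<sigma> a) = a"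
  using least_power_of_permutation(2)[of \<sigma> a] by (simp add: hd_map)

text \<open>Along the list positions advance by 1 modulo \<open>length cs\<close>, so a power of
  \<sigma> fixes \<open>e\<close> exactly if its exponent is a multiple of the length. Cycle lengths
  thus become a property of points, independent of how a cycle is listed.\<close>

lemma least_power_is_cycle:
  assumes "is_cycle \<sigma> cs" "e \<in> set cs"
  shows "least_power \<sigma> e = length cs"
proof -
  let ?p = "length cs"
  obtain i where i: "i < ?p" "e = cs ! i"
    using assms(2) by (metis in_set_conv_nth)
  have pow: "(\<sigma> ^^ k) e = cs ! ((i + k) mod ?p)" for k
  proof (induction k)
    case (Suc k)
    have "(i + k) mod ?p < ?p" using i by (intro mod_less_divisor) auto
    then show ?case
      using Suc is_cycle_nth[OF assms(1), of "(i + k) mod ?p"] by (simp add: mod_Suc_eq)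
  qed (use i in simp)
  have "(\<sigma> ^^ k) e = e \<longleftrightarrow> (i + k) mod ?p = i" for k
    using pow[of k] i assms(1) by (simp add: is_cycle_def nth_eq_iff_index_eq)
  moreover have "(i + k) mod ?p = i \<longleftrightarrow> ?p dvd k" for k
  proof
    assume "(i + k) mod ?p = i"
    then have "(i + k) mod ?p = i mod ?p" using i by simp
    then have "?p dvd (i + k) - i" by (metis le_add1 mod_eq_dvd_iff_nat)
    then show "?p dvd k" by simp
  qed (use i in auto)
  ultimately have "least_power \<sigma> e = (LEAST k. ?p dvd k \<and> k > 0)"
    by (simp add: least_power_def)
  also have "\<dots> = ?p"
    using i by (intro Least_equality) (auto dest: dvd_imp_le)
  finally show ?thesis .
qed

text \<open>The entries of \<open>cs\<close> are moved out one at a time. When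
  \<open>cs ! (k + 1)\<close> travels to its end, its preimage \<open>cs ! k\<close> already sits at
  the opposite end, while the preimages of the entries it passes still lie in the middle; so the
  preimages are in the right order for every exchange. The first entry of the cycle is at the front
  by assumption.\<close>

lemma swap_steps_to_stair:
  assumes cyc: "is_cycle \<sigma> cs" and \<sigma>: "permutation \<sigma>" and L: "distinct L" "\<sigma> ` set L = set L"
    "set cs \<subseteq> set L" "L \<noteq> []" "hd L = hd cs"
  shows "\<exists>M. (swap_step \<sigma>)\<^sup>*\<^sup>* L (wrap cs M)"
proof -
  have bij: "bij \<sigma>" using \<sigma> by (simp add: permutation)
  have inv_in: "inv \<sigma> e \<in> set L" if "e \<in> set L" for e
    using that L(2) bij by (metis bij_is_inj image_iff inv_f_f)
  have "\<exists>M. (swap_step \<sigma>)\<^sup>*\<^sup>* L (wrap (take (Suc k) cs) M)" if "k < length cs" for k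
    using that
  proof (induction k)
    case 0
    have "L = wrap (take (Suc 0) cs) (tl L)"
      using cyc L by (cases cs; cases L) (auto simp: wrap_def highs_def is_cycle_def)
    then show ?case by (metis rtranclp.rtrancl_refl)
  next
    case (Suc k)
    then obtain M where M: "(swap_step \<sigma>)\<^sup>*\<^sup>* L (wrap (take (Suc k) cs) M)" by auto
    let ?t = "take (Suc k) cs" and ?c = "cs ! Suc k"
    have d: "distinct (wrap ?t M)" and s: "set L = set ?t \<union> set M"
      using swap_steps_mset[OF M] L(1) set_wrap[of ?t M]
      by (metis mset_eq_imp_distinct_iff, metis set_mset_mset)
    have dM: "distinct M" "set ?t \<inter> set M = {}" using d by (simp_all add: distinct_wrap)
    have "?c \<notin> set ?t"
      using Suc.prems cyc by (auto simp: in_set_conv_nth is_cycle_def nth_eq_iff_index_eq)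
    then have "?c \<in> set M" using s L(3) Suc.prems by (metis UnE nth_mem subsetD)
    then obtain X1 X2 where X: "M = X1 @ ?c # X2" by (metis split_list)
    have invc: "inv \<sigma> ?c = cs ! k"
      using is_cycle_Suc[OF cyc Suc.prems] bij by (metis bij_is_inj inv_f_f)
    have tk: "?t = take k cs @ [cs ! k]" and lk: "length (take k cs) = k"
      using Suc.prems by (simp_all add: take_Suc_conv_app_nth)
    \<comment> \<open>The outer entries \<open>cs ! 0\<close>, ..., \<open>cs ! k\<close> have the
      images \<open>cs ! 1\<close>, ..., \<open>cs ! (k + 1)\<close>, so apart from
      \<open>?c\<close> no entry of the middle has an outer preimage.\<close>
    have inve: "inv \<sigma> e \<in> set M" if "e \<in> set M" "e \<noteq> ?c" for e
    proof (rule ccontr)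
      assume "inv \<sigma> e \<notin> set M"
      then have "inv \<sigma> e \<in> set ?t" using inv_in[of e] s that by auto
      then obtain j where j: "j \<le> k" "inv \<sigma> e = cs ! j"
        using Suc.prems by (auto simp: in_set_conv_nth less_Suc_eq_le)
      then have "e = \<sigma> (cs ! j)" using bij by (metis bij_inv_eq_iff)
      also have "\<dots> = cs ! Suc j" using is_cycle_Suc[OF cyc, of j] j Suc.prems by simp
      finally have e: "e = cs ! Suc j" .
      with that have "j < k" using j by (metis le_neq_implies_less)
      then have "e \<in> set ?t" using e Suc.prems by (auto simp: in_set_conv_nth intro!: exI[of _ "Suc j"])
      then show False using dM that by auto
    qed
    have t2: "take (Suc (Suc k)) cs = ?t @ [?c]"
      using Suc.prems by (simp add: take_Suc_conv_app_nth)
    have lt: "length ?t = Suc k" using Suc.prems by simp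
    show ?case
    proof (cases "even k")
      case True
      have c: "cs ! k \<in> set (lows ?t)" using True lk by (simp add: tk lows_highs_snoc)
      have "(swap_step \<sigma>)\<^sup>*\<^sup>* ((lows ?t @ X1) @ ?c # X2 @ rev (highs ?t))
          ((lows ?t @ X1) @ X2 @ ?c # rev (highs ?t))"
      proof (rule swap_steps_right)
        fix B1 e B2 assume B: "X2 = B1 @ e # B2"
        have "inv \<sigma> e \<in> set M" using X B dM by (intro inve) auto
        then have "before ((lows ?t @ X1) @ B1 @ ?c # e # B2 @ rev (highs ?t)) (inv \<sigma> ?c) (inv \<sigma> e)"
          using c X B by (auto simp: invc before_append)
        then show "before ((lows ?t @ X1) @ B1 @ ?c # e # B2 @ rev (highs ?t)) (\<sigma> ?c) (\<sigma> e) \<or>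
            before ((lows ?t @ X1) @ B1 @ ?c # e # B2 @ rev (highs ?t)) (inv \<sigma> ?c) (inv \<sigma> e)" ..
      qed
      then have "(swap_step \<sigma>)\<^sup>*\<^sup>* (wrap ?t M) (wrap (?t @ [?c]) (X1 @ X2))"
        unfolding wrap_snoc lt using True by (simp add: wrap_def X)
      then show ?thesis using M t2 by (metis rtranclp_trans)
    next
      case False
      have c: "cs ! k \<in> set (highs ?t)" using False lk by (simp add: tk lows_highs_snoc)
      have "(swap_step \<sigma>)\<^sup>*\<^sup>* (lows ?t @ X1 @ ?c # (X2 @ rev (highs ?t)))
          (lows ?t @ ?c # X1 @ (X2 @ rev (highs ?t)))"
      proof (rule swap_steps_left)
        fix B1 e B2 assume B: "X1 = B1 @ e # B2"
        have "inv \<sigma> e \<in> set M" using X B dM by (intro inve) auto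
        then have "before (lows ?t @ B1 @ e # ?c # B2 @ (X2 @ rev (highs ?t))) (inv \<sigma> e) (inv \<sigma> ?c)"
          using c X B by (auto simp: invc before_append)
        then show "before (lows ?t @ B1 @ e # ?c # B2 @ (X2 @ rev (highs ?t))) (\<sigma> e) (\<sigma> ?c) \<or>
            before (lows ?t @ B1 @ e # ?c # B2 @ (X2 @ rev (highs ?t))) (inv \<sigma> e) (inv \<sigma> ?c)" ..
      qed
      then have "(swap_step \<sigma>)\<^sup>*\<^sup>* (wrap ?t M) (wrap (?t @ [?c]) (X1 @ X2))"
        unfolding wrap_snoc lt using False by (simp add: wrap_def X)
      then show ?thesis using M t2 by (metis rtranclp_trans)
    qed
  qed
  from this[of "length cs - 1"] show ?thesis
    using cyc by (cases cs) (auto simp: is_cycle_def)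
qed

lemma ex_wrap_append: "\<exists>R. wrap (xs @ ys) M = wrap xs R"
proof (induction ys arbitrary: M rule: rev_induct)
  case (snoc y ys)
  show ?case unfolding append_assoc[symmetric] wrap_snoc by (rule snoc)
qed auto

text \<open>
  An inner cycle \<open>d\<close> can be brought outside of an odd cycle \<open>c\<close>: starting with the last entry,
  each \<open>c\<^sub>i\<close> is moved inwards past the \<open>d\<^sub>j\<close> with \<open>j \<le> i\<close> on its side, which is allowed because
  \<open>c\<^sub>i\<^sub>+\<^sub>1\<close> has already been moved past \<open>d\<^sub>j\<^sub>+\<^sub>1\<close>. The last entry of \<open>c\<close> is on the low
  side, and \<open>c\<^sub>0\<close> is the lowest entry of all, so its move is allowed as well.
\<close>

lemma swap_steps_exchange_longer:
  assumes c: "is_cycle \<sigma> cs" and d: "is_cycle \<sigma> ds" and odd: "odd (length cs)"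
    and len: "length cs < length ds" and L: "distinct (wrap cs (wrap ds M))"
  shows "\<exists>R. (swap_step \<sigma>)\<^sup>*\<^sup>* (wrap cs (wrap ds M)) (ds ! 0 # R)"
proof -
  let ?p = "length cs"
  \<comment> \<open>\<open>i\<close> counts the entries of either cycle whose places are still to be
    exchanged, and it decreases. For \<open>i < ?p\<close> the entry \<open>ds ! i\<close> is
    already directly outside \<open>cs ! i\<close>, which orders the images of
    \<open>cs ! (i - 1)\<close> and \<open>ds ! (i - 1)\<close> for the next move. For
    \<open>i = ?p\<close> it suffices that \<open>ds ! i\<close> exists in the middle, as
    \<open>length cs < length ds\<close> guarantees.\<close>
  define good where "good i R \<longleftrightarrow>
    (i < ?p \<longrightarrow> (\<exists>R'. R = (if even i then ds ! i # cs ! i # R' else R' @ [cs ! i, ds ! i]))) \<and>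
    (i = ?p \<longrightarrow> ds ! i \<in> set R)" for i and R :: "'a list"
  have "\<exists>R. (swap_step \<sigma>)\<^sup>*\<^sup>* (wrap cs (wrap ds M)) (wrap (take i cs) (wrap (take i ds) R)) \<and> good i R"
    if "i \<le> ?p" for i
    using that
  proof (induction i rule: inc_induct)
    case base
    obtain R where R: "wrap ds M = wrap (take ?p ds) R"
      using ex_wrap_append[of "take ?p ds" "drop ?p ds" M] by auto
    have "ds ! ?p \<in> set (wrap ds M)" using len by (simp add: set_wrap)
    moreover have "ds ! ?p \<notin> set (take ?p ds)"
      using len d by (auto simp: in_set_conv_nth is_cycle_def nth_eq_iff_index_eq)
    ultimately have "ds ! ?p \<in> set R" by (auto simp: R set_wrap)
    then show ?case using R by (auto simp: good_def)
  next
    case (step i)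
    then obtain R where R: "(swap_step \<sigma>)\<^sup>*\<^sup>* (wrap cs (wrap ds M)) (wrap (take (Suc i) cs) (wrap (take (Suc i) ds) R))"
      and g: "good (Suc i) R" by auto
    let ?P = "lows (take i cs)" and ?Q = "rev (highs (take i cs))"
    let ?D = "lows (take i ds)" and ?E = "rev (highs (take i ds))"
    have tc: "take (Suc i) cs = take i cs @ [cs ! i]" and td: "take (Suc i) ds = take i ds @ [ds ! i]"
      using step len by (simp_all add: take_Suc_conv_app_nth)
    have li: "length (take i cs) = i" "length (take i ds) = i" using step len by auto
    have \<sigma>d: "\<sigma> (ds ! j) = ds ! Suc j" if "j \<le> i" for j
      using is_cycle_Suc[OF d, of j] that step len by simp
    show ?case
    proof (cases "even i")
      case True
      have "(swap_step \<sigma>)\<^sup>*\<^sup>* (?P @ cs ! i # (?D @ [ds ! i]) @ (R @ ?E @ ?Q))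
        (?P @ (?D @ [ds ! i]) @ cs ! i # (R @ ?E @ ?Q))"
      proof (rule swap_steps_right)
        fix B1 e B2 assume B: "?D @ [ds ! i] = B1 @ e # B2"
        then have "e \<in> set (?D @ [ds ! i])" by simp
        then obtain j where j: "e = ds ! j" "j \<le> i" "even j"
          using True li by (auto simp: set_lows)
        have "Suc j < i" if "j < i"
          using that j True by (metis Suc_lessI even_Suc)
        then have e: "\<sigma> e = ds ! Suc j" "j < i \<Longrightarrow> \<sigma> e \<in> set ?E"
          using j True li by (auto simp: \<sigma>d set_highs intro!: exI[of _ "Suc j"])
        show "before (?P @ B1 @ cs ! i # e # B2 @ (R @ ?E @ ?Q)) (\<sigma> (cs ! i)) (\<sigma> e) \<or>
          before (?P @ B1 @ cs ! i # e # B2 @ (R @ ?E @ ?Q)) (inv \<sigma> (cs ! i)) (inv \<sigma> e)"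
        proof (cases "Suc i < ?p")
          case True': True
          then obtain R' where R': "R = R' @ [cs ! Suc i, ds ! Suc i]"
            using g True by (auto simp: good_def)
          show ?thesis
            using e j is_cycle_Suc[OF c True'] by (cases "j = i") (auto simp: R' before_append)
        next
          case False
          then have Sp: "Suc i = ?p" using step by simp
          then have R': "ds ! Suc i \<in> set R" using g by (simp add: good_def)
          have e': "\<sigma> e \<in> set (R @ ?E @ ?Q)"
            using e R' j by (cases "j = i") auto
          \<comment> \<open>The image of the last entry is \<open>cs ! 0\<close>. If
            \<open>i = 0\<close>, the cycle is a fixed point and the image is the moving entry
            itself, which stands before the remaining list.\<close>
          have "\<sigma> (cs ! i) = cs ! i \<or> \<sigma> (cs ! i) \<in> set ?P"
            using is_cycle_last[OF c Sp] li by (cases i) (auto simp: set_lows)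
          then show ?thesis using e' by (auto simp: before_append)
        qed
      qed
      then have "(swap_step \<sigma>)\<^sup>*\<^sup>* (wrap (take (Suc i) cs) (wrap (take (Suc i) ds) R))
        (wrap (take i cs) (wrap (take i ds) (ds ! i # cs ! i # R)))"
        unfolding tc td wrap_snoc li using True by (simp add: wrap_def)
      then show ?thesis
        using R True step by (intro exI[of _ "ds ! i # cs ! i # R"]) (auto simp: good_def)
    next
      case False
      then have Sp: "Suc i < ?p" using odd step by (metis Suc_lessI even_Suc)
      obtain R' where R': "R = ds ! Suc i # cs ! Suc i # R'"
        using g False Sp by (auto simp: good_def)
      have "(swap_step \<sigma>)\<^sup>*\<^sup>* ((?P @ ?D @ R) @ (ds ! i # ?E) @ cs ! i # ?Q)
        ((?P @ ?D @ R) @ cs ! i # (ds ! i # ?E) @ ?Q)"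
      proof (rule swap_steps_left)
        fix B1 e B2 assume B: "ds ! i # ?E = B1 @ e # B2"
        then have "e \<in> set (ds ! i # ?E)" by simp
        then obtain j where j: "e = ds ! j" "j \<le> i" "odd j"
          using False li by (auto simp: set_highs)
        have "Suc j < i" if "j < i"
          using that j False by (metis Suc_lessI even_Suc)
        then have e: "\<sigma> e = ds ! Suc j" "j < i \<Longrightarrow> \<sigma> e \<in> set ?D"
          using j False li by (auto simp: \<sigma>d set_lows intro!: exI[of _ "Suc j"])
        show "before ((?P @ ?D @ R) @ B1 @ e # cs ! i # B2 @ ?Q) (\<sigma> e) (\<sigma> (cs ! i)) \<or>
          before ((?P @ ?D @ R) @ B1 @ e # cs ! i # B2 @ ?Q) (inv \<sigma> e) (inv \<sigma> (cs ! i))"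
          using e j is_cycle_Suc[OF c Sp] by (cases "j = i") (auto simp: R' before_append)
      qed
      then have "(swap_step \<sigma>)\<^sup>*\<^sup>* (wrap (take (Suc i) cs) (wrap (take (Suc i) ds) R))
        (wrap (take i cs) (wrap (take i ds) (R @ [cs ! i, ds ! i])))"
        unfolding tc td wrap_snoc li using False by (simp add: wrap_def)
      then show ?thesis
        using R False step by (intro exI[of _ "R @ [cs ! i, ds ! i]"]) (auto simp: good_def)
    qed
  qed
  from this[of 0] show ?thesis
    using odd by (auto simp: good_def odd_pos)
qed

text \<open>Positions alternate in parity along the cycle, also at the return from the last
  position, which is odd, to position 0.\<close>

lemma is_cycle_even:
  assumes d: "is_cycle \<sigma> ds" and even: "even (length ds)"
  shows "e \<in> set (lows ds) \<Longrightarrow> \<sigma> e \<in> set (highs ds)"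
    and "e \<in> set (highs ds) \<Longrightarrow> \<sigma> e \<in> set (lows ds)"
proof -
  show "\<sigma> e \<in> set (highs ds)" if e: "e \<in> set (lows ds)"
  proof -
    obtain j where "j < length ds" "even j" "ds ! j = e" using e by (auto simp: set_lows)
    moreover from this have "Suc j < length ds" using even by (metis Suc_lessI even_Suc)
    ultimately show ?thesis
      using is_cycle_Suc[OF d, of j] by (auto simp: set_highs intro!: exI[of _ "Suc j"])
  qed
  show "\<sigma> e \<in> set (lows ds)" if e: "e \<in> set (highs ds)"
  proof -
    obtain j where j: "j < length ds" "odd j" "e = ds ! j" using e by (auto simp: set_highs)
    show ?thesis
    proof (cases "Suc j < length ds")
      case True
      then show ?thesis
        using is_cycle_Suc[OF d, of j] j by (auto simp: set_lows intro!: exI[of _ "Suc j"])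
    next
      case False
      then show ?thesis
        using is_cycle_last[OF d, of j] j by (auto simp: set_lows intro!: exI[of _ 0])
    qed
  qed
qed

text \<open>
  Here the cycle \<open>d\<close> may be shorter, but it alternates perfectly between its low and its high
  entries, and each \<open>c\<^sub>i\<close> can pass all of them on its side.
\<close>

lemma swap_steps_exchange_even:
  assumes c: "is_cycle \<sigma> cs" and d: "is_cycle \<sigma> ds" and odd: "odd (length cs)"
    and even: "even (length ds)"
  shows "\<exists>R. (swap_step \<sigma>)\<^sup>*\<^sup>* (wrap cs (wrap ds M)) (ds ! 0 # R)"
proof -
  let ?p = "length cs"
  have d0: "ds \<noteq> []" using d by (simp add: is_cycle_def)
  note dl = is_cycle_even(1)[OF d even] and dh = is_cycle_even(2)[OF d even]
  \<comment> \<open>Downward induction: \<open>i\<close> entries of \<open>cs\<close> are still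
    outside of \<open>ds\<close>. That \<open>cs ! i\<close> lies in the middle is recorded because
    it is the image of the entry moved next.\<close>
  have "\<exists>R. (swap_step \<sigma>)\<^sup>*\<^sup>* (wrap cs (wrap ds M)) (wrap (take i cs) (wrap ds R)) \<and>
      (i < ?p \<longrightarrow> cs ! i \<in> set R)"
    if "i \<le> ?p" for i
    using that
  proof (induction i rule: inc_induct)
    case base
    show ?case by auto
  next
    case (step i)
    then obtain R where R: "(swap_step \<sigma>)\<^sup>*\<^sup>* (wrap cs (wrap ds M)) (wrap (take (Suc i) cs) (wrap ds R))"
      and g: "Suc i < ?p \<Longrightarrow> cs ! Suc i \<in> set R" by auto
    let ?P = "lows (take i cs)" and ?Q = "rev (highs (take i cs))"
    have tc: "take (Suc i) cs = take i cs @ [cs ! i]"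
      using step by (simp add: take_Suc_conv_app_nth)
    have li: "length (take i cs) = i" using step by auto
    show ?case
    proof (cases "Parity.even i")
      case True
      have "\<sigma> (cs ! i) = cs ! i \<or> \<sigma> (cs ! i) \<in> set ?P \<union> set R"
      proof (cases "Suc i < ?p")
        case True
        then show ?thesis using g is_cycle_Suc[OF c True] by auto
      next
        case False
        then have "\<sigma> (cs ! i) = cs ! 0" using is_cycle_last[OF c, of i] step by simp
        then show ?thesis using li step by (cases i) (auto simp: set_lows)
      qed
      then have "(swap_step \<sigma>)\<^sup>*\<^sup>* (?P @ cs ! i # lows ds @ (R @ rev (highs ds) @ ?Q))
        (?P @ lows ds @ cs ! i # (R @ rev (highs ds) @ ?Q))"
        by (intro swap_steps_right) (use dl in \<open>auto simp: before_append\<close>)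
      then have "(swap_step \<sigma>)\<^sup>*\<^sup>* (wrap (take (Suc i) cs) (wrap ds R))
        (wrap (take i cs) (wrap ds (cs ! i # R)))"
        unfolding tc wrap_snoc li using True by (simp add: wrap_def)
      then show ?thesis using R by (intro exI[of _ "cs ! i # R"]) auto
    next
      case False
      then have Sp: "Suc i < ?p" using odd step by (metis Suc_lessI even_Suc)
      have dh': "\<sigma> e \<in> set (lows ds)" if "rev (highs ds) = B1 @ e # B2" for B1 e B2
        using that by (intro dh) (metis in_set_conv_decomp set_rev)
      have "(swap_step \<sigma>)\<^sup>*\<^sup>* ((?P @ lows ds @ R) @ rev (highs ds) @ cs ! i # ?Q)
        ((?P @ lows ds @ R) @ cs ! i # rev (highs ds) @ ?Q)"
        by (intro swap_steps_left)
          (use dh' g[OF Sp] is_cycle_Suc[OF c Sp] in \<open>auto simp: before_append\<close>)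
      then have "(swap_step \<sigma>)\<^sup>*\<^sup>* (wrap (take (Suc i) cs) (wrap ds R))
        (wrap (take i cs) (wrap ds (R @ [cs ! i])))"
        unfolding tc wrap_snoc li using False by (simp add: wrap_def)
      then show ?thesis using R by (intro exI[of _ "R @ [cs ! i]"]) auto
    qed
  qed
  from this[of 0] obtain R where "(swap_step \<sigma>)\<^sup>*\<^sup>* (wrap cs (wrap ds M)) (wrap ds R)" by auto
  moreover have "\<exists>R'. wrap ds R = ds ! 0 # R'"
    using d0 by (cases ds) (auto simp: wrap_def lows_Cons)
  ultimately show ?thesis by metis
qed

section \<open>Nesting all cycles of a permutation\<close>

definition arr :: "'a list list \<Rightarrow> 'a list"
  where "arr css = foldr wrap css []"

lemma arr_simps [simp]: "arr [] = []" "arr (cs # css) = wrap cs (arr css)"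
  by (simp_all add: arr_def)

lemma mset_arr: "mset (arr css) = mset (concat css)"
  by (induction css) (simp_all add: mset_wrap)

lemma set_arr: "set (arr css) = (\<Union>cs\<in>set css. set cs)"
  using mset_arr[of css] by (metis set_concat set_mset_mset)

text \<open>If the tail is valid and \<open>p\<close> is positive, validity can only fail because
  \<open>p\<close> is odd and the next length is even, or odd and larger than \<open>p\<close>.
  These are the situations of the two exchange lemmas.\<close>

fun valid :: "nat list \<Rightarrow> bool" where
  "valid [] \<longleftrightarrow> True"
| "valid (p # ps) \<longleftrightarrow> p > 0 \<and> (even p \<or> (\<forall>q\<in>set ps. odd q \<and> q \<le> p)) \<and> valid ps"

lemma least_power_arr:
  assumes "\<forall>cs\<in>set css. is_cycle \<sigma> cs" "e \<in> set (arr css)"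
  shows "least_power \<sigma> e \<in> length ` set css"
proof -
  obtain cs where cs: "cs \<in> set css" "e \<in> set cs" using assms(2) by (auto simp: set_arr)
  with assms(1) have "least_power \<sigma> e = length cs" by (intro least_power_is_cycle) auto
  with cs show ?thesis by auto
qed

text \<open>One correction is enough. If the outermost cycle \<open>cs\<close> is out of order, the
  next cycle \<open>ds\<close> is even, or it is odd, longer than \<open>cs\<close> and, by validity
  of the tail, at least as long as all others. Bringing \<open>ds\<close> to the front and sorting
  the remainder again therefore gives a valid list.\<close>

lemma swap_steps_to_arr:
  assumes "permutation \<sigma>" "distinct L" "\<sigma> ` set L = set L"
  shows "\<exists>css. (swap_step \<sigma>)\<^sup>*\<^sup>* L (arr css) \<and> (\<forall>cs\<in>set css. is_cycle \<sigma> cs) \<and> valid (map length css)"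
  using assms(2-)
proof (induction L rule: length_induct)
  case (1 L)
  note \<sigma> = assms(1)
  have inj: "inj \<sigma>" using \<sigma> by (simp add: permutation bij_is_inj)
  \<comment> \<open>Whatever point \<open>a\<close> is at the front, its cycle can be unfolded
    around the rest, which is shorter and is sorted by induction; afterwards only the outermost
    length may be out of order.\<close>
  have restart: "\<exists>cs css. (swap_step \<sigma>)\<^sup>*\<^sup>* L (arr (cs # css)) \<and> (\<forall>cs\<in>set (cs # css). is_cycle \<sigma> cs) \<and>
      valid (map length css) \<and> a \<in> set cs"
    if steps: "(swap_step \<sigma>)\<^sup>*\<^sup>* L (a # L')" for a L'
  proof -
    have m: "mset (a # L') = mset L" using swap_steps_mset[OF steps] .
    then have s: "set (a # L') = set L" "distinct (a # L')"
      using "1.prems" by (metis set_mset_mset, metis mset_eq_imp_distinct_iff)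
    let ?cs = "support \<sigma> a"
    have cs: "is_cycle \<sigma> ?cs" "hd ?cs = a" using is_cycle_support[OF \<sigma>] hd_support[OF \<sigma>] by auto
    have "(\<sigma> ^^ k) a \<in> set L" for k
      using s "1.prems" by (induction k) auto
    then have sub: "set ?cs \<subseteq> set (a # L')" using s by auto
    have "\<sigma> ` set (a # L') = set (a # L')" using s(1) "1.prems" by metis
    from swap_steps_to_stair[OF cs(1) \<sigma> s(2) this sub]
    obtain M where M: "(swap_step \<sigma>)\<^sup>*\<^sup>* (a # L') (wrap ?cs M)"
      using cs(2) by (metis list.sel(1) list.simps(3))
    have mM: "mset L = mset ?cs + mset M"
      using swap_steps_mset[OF M] m mset_wrap[of ?cs M] by simp
    have dM: "distinct M" "set ?cs \<inter> set M = {}" "set L = set ?cs \<union> set M"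
      using mM "1.prems" mset_eq_imp_distinct_iff[of L "?cs @ M"] mset_eq_setD[of L "?cs @ M"] by auto
    have ne: "?cs \<noteq> []" using cs(1) by (simp add: is_cycle_def)
    have lM: "length M < length L"
      using mM ne by (metis length_greater_0_conv less_add_same_cancel2 size_mset size_union)
    have "\<sigma> ` set M = set M"
    proof -
      have "set M = set L - set ?cs" using dM by auto
      then show ?thesis
        using is_cycle_image[OF cs(1)] "1.prems" by (metis image_set_diff[OF inj])
    qed
    then obtain css where css: "(swap_step \<sigma>)\<^sup>*\<^sup>* M (arr css)" "\<forall>cs\<in>set css. is_cycle \<sigma> cs"
        "valid (map length css)"
      using "1.IH" lM dM by blast
    have "(swap_step \<sigma>)\<^sup>*\<^sup>* L (arr (?cs # css))"
      using steps M swap_steps_wrap[OF css(1), of ?cs] by simp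
    moreover have "a \<in> set ?cs" using ne cs(2) by (metis hd_in_set)
    ultimately show ?thesis using css cs(1) by (intro exI[of _ ?cs] exI[of _ css]) auto
  qed
  show ?case
  proof (cases L)
    case Nil
    then show ?thesis by (intro exI[of _ "[]"]) simp
  next
    case (Cons a L')
    then obtain cs css where c: "(swap_step \<sigma>)\<^sup>*\<^sup>* L (arr (cs # css))"
        "\<forall>cs\<in>set (cs # css). is_cycle \<sigma> cs" "valid (map length css)"
      using restart[of a L'] by blast
    have l0: "length cs > 0" using c(2) by (simp add: is_cycle_def)
    show ?thesis
    proof (cases "valid (map length (cs # css))")
      case True
      then show ?thesis using c by blast
    next
      case False
      then have odd: "odd (length cs)" and "css \<noteq> []" using c(3) l0 by auto
      then obtain ds css' where css: "css = ds # css'" by (cases css) auto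
      have ds: "is_cycle \<sigma> ds" "is_cycle \<sigma> cs" using c css by auto
      have "(length cs < length ds \<and> Parity.odd (length ds)) \<or> even (length ds)"
        using False odd c(3) l0 unfolding css by fastforce
      moreover have "distinct (arr (cs # css))"
        using swap_steps_mset[OF c(1)] "1.prems"(1) by (metis mset_eq_imp_distinct_iff)
      ultimately obtain R where R: "(swap_step \<sigma>)\<^sup>*\<^sup>* (arr (cs # css)) (ds ! 0 # R)"
        using swap_steps_exchange_longer[OF ds(2,1) odd, of "arr css'"]
          swap_steps_exchange_even[OF ds(2,1) odd, of "arr css'"] unfolding css by auto
      obtain es css2 where e: "(swap_step \<sigma>)\<^sup>*\<^sup>* L (arr (es # css2))"
          "\<forall>cs\<in>set (es # css2). is_cycle \<sigma> cs" "valid (map length css2)" "ds ! 0 \<in> set es"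
        using restart[of "ds ! 0" R] c(1) R by (meson rtranclp_trans)
      have "ds ! 0 \<in> set ds" using ds(1) by (simp add: is_cycle_def)
      then have les: "length es = length ds"
        using least_power_is_cycle[OF ds(1)] least_power_is_cycle[of \<sigma> es "ds ! 0"] e by auto
      \<comment> \<open>Periods of points do not depend on the arrangement, so the new inner lengths
        occur among the old ones. For odd \<open>ds\<close> all old lengths are odd and at most
        \<open>length ds\<close>.\<close>
      have "Parity.odd (length f) \<and> length f \<le> length ds"
        if o: "Parity.odd (length ds)" and f: "f \<in> set css2" for f
      proof -
        have ff: "is_cycle \<sigma> f" "hd f \<in> set f" using f e(2) by (auto simp: is_cycle_def)
        have "hd f \<in> set (arr (es # css2))" using f ff by (auto simp: set_wrap set_arr)
        also have "\<dots> = set (arr (cs # css))"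
          using swap_steps_mset[OF e(1)] swap_steps_mset[OF c(1)] by (metis set_mset_mset)
        finally have "least_power \<sigma> (hd f) \<in> length ` set (cs # css)"
          using c(2) by (intro least_power_arr)
        then have "length f \<in> length ` set (cs # css)"
          using least_power_is_cycle[OF ff] by simp
        moreover have "length cs < length ds" using \<open>_ \<or> even (length ds)\<close> o by auto
        ultimately show ?thesis
          using odd o c(3) unfolding css by auto
      qed
      then have "valid (map length (es # css2))"
        using e(3) les ds(1) by (auto simp: is_cycle_def)
      then show ?thesis using e by blast
    qed
  qed
qed

section \<open>Arrangements and their lists of lengths\<close>

lemma wrap_map: "wrap (map f cs) (map f M) = map f (wrap cs M)"
proof (induction cs arbitrary: M rule: rev_induct)
  case (snoc c cs)
  show ?case
    using snoc[of "c # M"] snoc[of "M @ [c]"] by (simp add: wrap_snoc)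
qed simp

lemma arr_map: "arr (map (map f) css) = map f (arr css)"
  by (induction css) (simp_all add: wrap_map)

lemma wrap_inject:
  assumes "wrap cs M = wrap cs' M'" "length cs = length cs'"
  shows "cs = cs' \<and> M = M'"
  using assms
proof (induction cs arbitrary: cs' M M' rule: rev_induct)
  case (snoc c cs)
  then obtain d ds where d: "cs' = ds @ [d]" "length ds = length cs"
    by (metis length_append_singleton length_Suc_conv_rev)
  then show ?case
    using snoc.prems snoc.IH[of _ ds] by (auto simp: wrap_snoc split: if_splits)
qed simp

text \<open>The lengths determine the positions that each cycle occupies in the nested list, so
  nothing is lost by reading off the entries.\<close>

lemma arr_inject:
  assumes "arr css = arr css'" "map length css = map length css'"
  shows "css = css'"
  using assms
proof (induction css arbitrary: css')
  case (Cons cs css)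
  then show ?case by (cases css') (auto dest!: wrap_inject)
qed auto

lemma wrap_surj: "p \<le> length L \<Longrightarrow> \<exists>cs M. length cs = p \<and> wrap cs M = L"
proof (induction p)
  case (Suc p)
  then obtain cs M where M: "length cs = p" "wrap cs M = L" by auto
  then have ne: "M \<noteq> []" using Suc.prems length_wrap[of cs M] by auto
  show ?case
  proof (cases "even p")
    case True
    then show ?thesis using M ne
      by (intro exI[of _ "cs @ [hd M]"] exI[of _ "tl M"]) (simp add: wrap_snoc)
  next
    case False
    then show ?thesis using M ne
      by (intro exI[of _ "cs @ [last M]"] exI[of _ "butlast M"]) (simp add: wrap_snoc)
  qed
qed auto

lemma arr_surj: "length L = sum_list ps \<Longrightarrow> \<exists>css. map length css = ps \<and> arr css = L"
proof (induction ps arbitrary: L)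
  case (Cons p ps)
  then obtain cs M where M: "length cs = p" "wrap cs M = L"
    using wrap_surj[of p L] by auto
  then have "length M = sum_list ps" using Cons.prems length_wrap[of cs M] by simp
  then obtain css where "map length css = ps" "arr css = M" using Cons.IH by blast
  then show ?case using M by (intro exI[of _ "cs # css"]) simp
qed simp

text \<open>The permutation is the product of the given cycles; as they are disjoint, each factor
  fixes the entries of the others.\<close>

lemma ex_permutes_cycles:
  assumes "distinct (concat css)" "[] \<notin> set css"
  shows "\<exists>\<sigma>. \<sigma> permutes set (concat css) \<and> (\<forall>cs\<in>set css. is_cycle \<sigma> cs)"
  using assms
proof (induction css)
  case Nil
  then show ?case by (auto intro: permutes_id)
next
  case (Cons cs css)
  then obtain \<sigma> where \<sigma>: "\<sigma> permutes set (concat css)" "\<forall>cs\<in>set css. is_cycle \<sigma> cs" by auto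
  let ?c = "cycle_of_list cs"
  have c: "?c permutes set cs" by (rule cycle_permutes)
  have d: "set cs \<inter> set (concat css) = {}" "distinct cs" using Cons.prems by auto
  have "(?c \<circ> \<sigma>) permutes set (concat (cs # css))"
    using c \<sigma>(1) by (intro permutes_compose) (auto elim: permutes_subset)
  moreover have "is_cycle (?c \<circ> \<sigma>) cs"
  proof -
    have "\<sigma> e = e" if "e \<in> set cs" for e
      using permutes_not_in[OF \<sigma>(1), of e] d(1) that by blast
    then have "map (?c \<circ> \<sigma>) cs = map ?c cs" by simp
    then show ?thesis
      using cyclic_rotation[OF d(2), of 1] Cons.prems by (auto simp: is_cycle_def simp del: map_eq_conv)
  qed
  moreover have "is_cycle (?c \<circ> \<sigma>) es" if es: "es \<in> set css" for es
  proof -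
    have "map (?c \<circ> \<sigma>) es = map \<sigma> es"
    proof (rule map_cong)
      fix e assume "e \<in> set es"
      then have "\<sigma> e \<in> set es" using is_cycle_image[of \<sigma> es] \<sigma> es by auto
      then have "\<sigma> e \<notin> set cs" using d es by auto
      then show "(?c \<circ> \<sigma>) e = \<sigma> e" using permutes_not_in[OF c] by simp
    qed simp
    then show ?thesis using \<sigma>(2) es by (auto simp: is_cycle_def simp del: map_eq_conv)
  qed
  ultimately show ?case by (metis set_ConsD)
qed

section \<open>Length and conjugation steps\<close>

abbreviation adj :: "nat \<Rightarrow> nat \<Rightarrow> nat"
  where "adj i \<equiv> transpose i (Suc i)"

definition invs :: "(nat \<Rightarrow> nat) \<Rightarrow> (nat \<times> nat) set"
  where "invs w = {(a, b). a < b \<and> w b < w a}"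

definition len :: "(nat \<Rightarrow> nat) \<Rightarrow> nat"
  where "len w = card (invs w)"

lemma adj_permutes: "Suc i < n \<Longrightarrow> adj i permutes {..<n}"
  by (simp add: permutes_swap_id)

lemma adj_less_iff: "(a, b) \<noteq> (i, Suc i) \<Longrightarrow> (a, b) \<noteq> (Suc i, i) \<Longrightarrow> adj i a < adj i b \<longleftrightarrow> a < b"
  by (auto simp: transpose_def)

lemma permutes_less: "w permutes {..<n} \<Longrightarrow> a < n \<Longrightarrow> w a < (n::nat)"
  using permutes_in_image[of w "{..<n}" a] by simp

lemma finite_invs:
  assumes "w permutes {..<n::nat}"
  shows "finite (invs w)"
proof (rule finite_subset)
  show "invs w \<subseteq> {..<n} \<times> {..<n}"
  proof
    fix p assume p: "p \<in> invs w"
    obtain a b where ab: "p = (a, b)" "a < b" "w b < w a" using p by (auto simp: invs_def)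
    have "b < n"
    proof (rule ccontr)
      assume "\<not> b < n"
      then have "w b = b" using permutes_not_in[OF assms, of b] by simp
      with ab \<open>\<not> b < n\<close> show False
        using permutes_less[OF assms, of a] permutes_not_in[OF assms, of a] by (cases "a < n") auto
    qed
    with ab show "p \<in> {..<n} \<times> {..<n}" by auto
  qed
qed auto

text \<open>Applying \<open>adj i\<close> to both coordinates maps the inversions of
  \<open>w\<close> bijectively to those of \<open>w \<circ> adj i\<close> other than
  \<open>(i, Suc i)\<close>, because \<open>adj i\<close> reverses the order of no other
  pair.\<close>

lemma len_comp_adj:
  assumes w: "w permutes {..<n}" and "w i < w (Suc i)"
  shows "len (w \<circ> adj i) = Suc (len w)"
proof -
  let ?f = "map_prod (adj i) (adj i)"
  have inj: "inj_on ?f (invs w)"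
    by (rule inj_on_subset[OF prod.inj_map[OF inj_transpose inj_transpose] subset_UNIV])
  have eq: "invs (w \<circ> adj i) = insert (i, Suc i) (?f ` invs w)"
  proof (intro equalityI subsetI)
    fix p assume p: "p \<in> invs (w \<circ> adj i)"
    obtain a b where ab: "p = (a, b)" "a < b" "w (adj i b) < w (adj i a)"
      using p by (auto simp: invs_def)
    show "p \<in> insert (i, Suc i) (?f ` invs w)"
    proof (cases "(a, b) = (i, Suc i)")
      case False
      moreover from ab have "(a, b) \<noteq> (Suc i, i)" by auto
      ultimately have "adj i a < adj i b" using ab by (simp add: adj_less_iff)
      then have "(adj i a, adj i b) \<in> invs w" using ab by (simp add: invs_def)
      then have "?f (adj i a, adj i b) \<in> ?f ` invs w" by blast
      then show ?thesis by (simp add: ab)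
    qed (simp add: ab)
  next
    fix p assume "p \<in> insert (i, Suc i) (?f ` invs w)"
    then show "p \<in> invs (w \<circ> adj i)"
    proof
      assume "p = (i, Suc i)"
      then show ?thesis using assms(2) by (simp add: invs_def)
    next
      assume "p \<in> ?f ` invs w"
      then obtain a b where ab: "p = (adj i a, adj i b)" "a < b" "w b < w a"
        by (auto simp: invs_def)
      then have "(a, b) \<noteq> (i, Suc i)" "(a, b) \<noteq> (Suc i, i)" using assms(2) by auto
      then show ?thesis using ab by (simp add: invs_def adj_less_iff)
    qed
  qed
  have "(i, Suc i) \<notin> ?f ` invs w"
  proof
    assume "(i, Suc i) \<in> ?f ` invs w"
    then obtain a b where ab: "i = adj i a" "Suc i = adj i b" "a < b" by (auto simp: invs_def)
    then show False by (auto simp: transpose_def split: if_splits)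
  qed
  then show ?thesis
    unfolding len_def eq using finite_invs[OF w] inj by (simp add: card_image)
qed

lemma len_comp_adj_less:
  assumes w: "w permutes {..<n}" and "Suc i < n" "w (Suc i) < w i"
  shows "Suc (len (w \<circ> adj i)) = len w"
proof -
  have "len (w \<circ> adj i \<circ> adj i) = Suc (len (w \<circ> adj i))"
    using assms by (intro len_comp_adj[of _ n] permutes_compose adj_permutes) auto
  then show ?thesis by (simp add: comp_assoc)
qed

text \<open>Transfers each statement on right multiplication by \<open>adj i\<close> to left
  multiplication.\<close>

lemma len_inv:
  assumes "w permutes {..<n}"
  shows "len (inv w) = len w"
proof -
  have b: "bij w" using assms by (rule permutes_bij)
  then have inv: "inv w (w x) = x" "w (inv w x) = x" for x
    by (simp_all add: bij_is_inj bij_is_surj surj_f_inv_f)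
  have "bij_betw (\<lambda>(a, b). (w b, w a)) (invs w) (invs (inv w))"
    by (rule bij_betw_byWitness[of _ "\<lambda>(a, b). (inv w b, inv w a)"]) (auto simp: invs_def inv)
  then show ?thesis by (metis len_def bij_betw_same_card)
qed

lemma inv_adj_comp: "bij w \<Longrightarrow> inv (adj i \<circ> w) = inv w \<circ> adj i"
  by (simp add: o_inv_distrib)

lemma len_adj_comp:
  assumes w: "w permutes {..<n}" and "Suc i < n" "inv w i < inv w (Suc i)"
  shows "len (adj i \<circ> w) = Suc (len w)"
  using len_comp_adj[OF permutes_inv[OF w] assms(3)] len_inv[OF w]
    len_inv[OF permutes_compose[OF w adj_permutes[OF assms(2)]]]
  by (simp add: inv_adj_comp permutes_bij[OF w])

lemma len_adj_comp_less:
  assumes w: "w permutes {..<n}" and "Suc i < n" "inv w (Suc i) < inv w i"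
  shows "Suc (len (adj i \<circ> w)) = len w"
  using len_comp_adj_less[OF permutes_inv[OF w] assms(2,3)] len_inv[OF w]
    len_inv[OF permutes_compose[OF w adj_permutes[OF assms(2)]]]
  by (simp add: inv_adj_comp permutes_bij[OF w])

section \<open>Conjugation steps and their effect on the length\<close>

lemma permutes_Suc_neq: "w permutes S \<Longrightarrow> w i \<noteq> w (Suc i)"
  by (metis n_not_Suc_n permutes_inj inj_eq)

text \<open>The condition is stated by ascents: the first says that \<open>x \<circ> adj i\<close>
  is longer than \<open>x\<close>, the second that \<open>adj i \<circ> x\<close> is. In this form
  it matches the side condition of \<open>swap_step\<close>.\<close>

definition conj_step :: "nat \<Rightarrow> (nat \<Rightarrow> nat) \<Rightarrow> (nat \<Rightarrow> nat) \<Rightarrow> bool"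
  where "conj_step n x y \<longleftrightarrow> x permutes {..<n} \<and>
    (\<exists>i. Suc i < n \<and> (x i < x (Suc i) \<or> inv x i < inv x (Suc i)) \<and> y = adj i \<circ> x \<circ> adj i)"

lemma conj_step_permutes: "conj_step n x y \<Longrightarrow> y permutes {..<n}"
  by (auto simp: conj_step_def intro!: permutes_compose adj_permutes)

lemma conj_steps_permutes: "(conj_step n)\<^sup>*\<^sup>* x y \<Longrightarrow> x permutes {..<n} \<Longrightarrow> y permutes {..<n}"
  by (induction rule: rtranclp_induct) (auto dest: conj_step_permutes)

lemma conj_step_cases:
  assumes "conj_step n x y"
  obtains i where "Suc i < n" "y = adj i \<circ> x \<circ> adj i" "len (x \<circ> adj i) = Suc (len x)"
    | i where "Suc i < n" "y = adj i \<circ> x \<circ> adj i" "len (adj i \<circ> x) = Suc (len x)"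
  using assms len_comp_adj len_adj_comp by (auto simp: conj_step_def)

lemma len_adj_comp_cases:
  assumes "w permutes {..<n}" "Suc i < n"
  shows "len (adj i \<circ> w) = Suc (len w) \<or> Suc (len (adj i \<circ> w)) = len w"
  using len_adj_comp[OF assms] len_adj_comp_less[OF assms] permutes_Suc_neq[OF permutes_inv[OF assms(1)], of i]
  by (metis nat_neq_iff)

lemma len_comp_adj_cases:
  assumes "w permutes {..<n}" "Suc i < n"
  shows "len (w \<circ> adj i) = Suc (len w) \<or> Suc (len (w \<circ> adj i)) = len w"
  using len_comp_adj[OF assms(1)] len_comp_adj_less[OF assms] permutes_Suc_neq[OF assms(1), of i]
  by (metis nat_neq_iff)

text \<open>One of the two multiplications raises the length by 1 and the other one changes it by 1,
  so a step changes the length by 0 or 2.\<close>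

lemma conj_step_len:
  assumes "conj_step n x y"
  shows "len x \<le> len y"
proof -
  have x: "x permutes {..<n}" using assms by (simp add: conj_step_def)
  from assms show ?thesis
  proof (cases rule: conj_step_cases)
    case (1 i)
    have "(x \<circ> adj i) permutes {..<n}" by (rule permutes_compose[OF adj_permutes[OF 1(1)] x])
    from len_adj_comp_cases[OF this 1(1)] show ?thesis
      unfolding 1(2) comp_assoc 1(3) by linarith
  next
    case (2 i)
    have "(adj i \<circ> x) permutes {..<n}" by (rule permutes_compose[OF x adj_permutes[OF 2(1)]])
    from len_comp_adj_cases[OF this 2(1)] show ?thesis
      unfolding 2(2,3) by linarith
  qed
qed

lemma conj_steps_len: "(conj_step n)\<^sup>*\<^sup>* x y \<Longrightarrow> len x \<le> len y"
  by (induction rule: rtranclp_induct) (auto dest: conj_step_len)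

text \<open>If \<open>x \<circ> adj i\<close> is longer than \<open>x\<close>, it equals
  \<open>adj i \<circ> y\<close> and is longer than \<open>y\<close> as well, which permits the step
  back; the other case is the mirror image.\<close>

lemma conj_step_sym:
  assumes "conj_step n x y" "len y = len x"
  shows "conj_step n y x"
proof -
  have x: "x permutes {..<n}" using assms by (simp add: conj_step_def)
  have y: "y permutes {..<n}" using assms(1) by (rule conj_step_permutes)
  from assms(1) obtain i where i: "Suc i < n" "y = adj i \<circ> x \<circ> adj i"
      "len (x \<circ> adj i) = Suc (len x) \<or> len (adj i \<circ> x) = Suc (len x)"
    by (cases rule: conj_step_cases) auto
  have *: "adj i \<circ> y = x \<circ> adj i" "y \<circ> adj i = adj i \<circ> x" "x = adj i \<circ> y \<circ> adj i"
    using i(2) by (auto simp: fun_eq_iff)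
  have "\<not> inv y (Suc i) < inv y i" if "len (x \<circ> adj i) = Suc (len x)"
    using len_adj_comp_less[OF y i(1)] that assms(2) *(1,2) by auto
  moreover have "\<not> y (Suc i) < y i" if "len (adj i \<circ> x) = Suc (len x)"
    using len_comp_adj_less[OF y i(1)] that assms(2) *(1,2) by auto
  ultimately have "y i < y (Suc i) \<or> inv y i < inv y (Suc i)"
    using i(3) permutes_Suc_neq[OF y, of i] permutes_Suc_neq[OF permutes_inv[OF y], of i]
    by (meson nat_neq_iff)
  then show ?thesis using i(1) y *(3) by (auto simp: conj_step_def)
qed

lemma conj_steps_sym:
  assumes "(conj_step n)\<^sup>*\<^sup>* x y" "len y = len x"
  shows "(conj_step n)\<^sup>*\<^sup>* y x"
  using assms
proof (induction rule: converse_rtranclp_induct)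
  case (step x z)
  then have "len z = len x" "len y = len z"
    using conj_step_len[of n x z] conj_steps_len[of n z y] by auto
  then show ?case using step conj_step_sym by (meson rtranclp.rtrancl_into_rtrancl)
qed auto

section \<open>Canonical permutations\<close>

definition labelling :: "nat list \<Rightarrow> nat \<Rightarrow> nat"
  where "labelling L j = (if j < length L then L ! j else j)"

definition relabel :: "(nat \<Rightarrow> nat) \<Rightarrow> nat list \<Rightarrow> nat \<Rightarrow> nat"
  where "relabel \<sigma> L = inv (labelling L) \<circ> \<sigma> \<circ> labelling L"

lemma map_labelling: "map (labelling L) [0..<length L] = L"
  by (rule nth_equalityI) (auto simp: labelling_def)

lemma labelling_permutes:
  assumes "mset L = mset [0..<n]"
  shows "labelling L permutes {..<n}"
proof (rule bij_imp_permutes)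
  have len: "length L = n" using assms by (metis length_upt mset_eq_length minus_nat.diff_0)
  have "distinct L" using mset_eq_imp_distinct_iff[OF assms] by simp
  moreover have "set L = {..<n}" using mset_eq_setD[OF assms] by (simp add: atLeast0LessThan)
  ultimately have "bij_betw ((!) L) {..<n} {..<n}" using len by (intro bij_betw_nth) auto
  then show "bij_betw (labelling L) {..<n} {..<n}"
    using bij_betw_cong[of "{..<n}" "labelling L" "(!) L"] len by (simp add: labelling_def)
qed (use mset_eq_length[OF assms] in \<open>auto simp: labelling_def\<close>)

lemma relabel_permutes:
  assumes "mset L = mset [0..<n]" "\<sigma> permutes {..<n}"
  shows "relabel \<sigma> L permutes {..<n}"
  unfolding relabel_def
  using labelling_permutes[OF assms(1)] assms(2) by (intro permutes_compose permutes_inv) auto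

lemma relabel_upt: "relabel \<sigma> [0..<n] = \<sigma>"
proof -
  have "labelling [0..<n] = id" by (auto simp: labelling_def)
  then show ?thesis by (simp add: relabel_def)
qed

lemma before_labelling:
  assumes "before L u v" "labelling L permutes {..<n}" "length L = n"
  shows "inv (labelling L) u < inv (labelling L) v"
proof -
  have "\<exists>i j. i < j \<and> j < length L \<and> L ! i = u \<and> L ! j = v"
    using assms(1)
  proof (induction L)
    case (Cons x L)
    show ?case
    proof (cases "before L u v")
      case True
      then obtain i j where "i < j" "j < length L" "L ! i = u" "L ! j = v" using Cons.IH by auto
      then show ?thesis by (intro exI[of _ "Suc i"] exI[of _ "Suc j"]) simp
    next
      case False
      then obtain j where "u = x" "j < length L" "L ! j = v"
        using Cons.prems by (auto simp: in_set_conv_nth)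
      then show ?thesis by (intro exI[of _ 0] exI[of _ "Suc j"]) simp
    qed
  qed simp
  then obtain i j where ij: "i < j" "j < length L" "labelling L i = u" "labelling L j = v"
    by (auto simp: labelling_def)
  then have "inv (labelling L) u = i" "inv (labelling L) v = j"
    using permutes_inv_eq[OF assms(2)] by blast+
  with ij show ?thesis by simp
qed

text \<open>Exchanging neighbours in the list multiplies the labelling by \<open>adj i\<close> on
  the right, hence conjugates the permutation of the labels; order in the list is order of the
  labels, so the side conditions correspond.\<close>

lemma conj_step_relabel:
  assumes "swap_step \<sigma> L L'" "mset L = mset [0..<n]" "\<sigma> permutes {..<n}"
  shows "conj_step n (relabel \<sigma> L) (relabel \<sigma> L')"
  using assms(1)
proof cases
  case (1 xs a b ys)
  let ?l = "labelling L" and ?i = "length xs"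
  have l: "?l permutes {..<n}" by (rule labelling_permutes[OF assms(2)])
  have n: "length L = n" using mset_eq_length[OF assms(2)] by simp
  then have i: "Suc ?i < n" using 1 by auto
  have ab: "?l ?i = a" "?l (Suc ?i) = b" using 1 by (auto simp: labelling_def nth_append)
  have "labelling L' = ?l \<circ> adj ?i"
  proof
    fix j
    show "labelling L' j = (?l \<circ> adj ?i) j"
      using 1 by (auto simp: labelling_def transpose_def nth_append nth_Cons' not_less le_Suc_eq)
  qed
  moreover have "inv (?l \<circ> adj ?i) = adj ?i \<circ> inv ?l"
    using permutes_bij[OF l] by (simp add: o_inv_distrib)
  ultimately have y: "relabel \<sigma> L' = adj ?i \<circ> relabel \<sigma> L \<circ> adj ?i"
    by (simp add: relabel_def comp_assoc)
  have inv: "inv (relabel \<sigma> L) = inv ?l \<circ> inv \<sigma> \<circ> ?l"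
    using permutes_bij[OF l] permutes_bij[OF assms(3)] permutes_inv_inv[OF l]
    by (simp add: relabel_def o_inv_distrib bij_comp bij_imp_bij_inv comp_assoc)
  have "relabel \<sigma> L ?i < relabel \<sigma> L (Suc ?i) \<or>
    inv (relabel \<sigma> L) ?i < inv (relabel \<sigma> L) (Suc ?i)"
    unfolding inv using 1 before_labelling[OF _ l n] ab by (auto simp: relabel_def)
  then show ?thesis
    using y i relabel_permutes[OF assms(2,3)] by (auto simp: conj_step_def)
qed

lemma conj_steps_relabel:
  assumes "(swap_step \<sigma>)\<^sup>*\<^sup>* L L'" "mset L = mset [0..<n]" "\<sigma> permutes {..<n}"
  shows "(conj_step n)\<^sup>*\<^sup>* (relabel \<sigma> L) (relabel \<sigma> L')"
  using assms(1)
proof (induction rule: rtranclp_induct)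
  case (step L1 L2)
  have "conj_step n (relabel \<sigma> L1) (relabel \<sigma> L2)"
    using conj_step_relabel[OF step.hyps(2) _ assms(3)] swap_steps_mset[OF step.hyps(1)] assms(2) by simp
  with step.IH show ?case by (rule rtranclp.rtrancl_into_rtrancl[of "conj_step n"])
qed simp

section \<open>Existence and uniqueness of canonical permutations\<close>

definition is_canon :: "nat list \<Rightarrow> (nat \<Rightarrow> nat) \<Rightarrow> bool"
  where "is_canon ps x \<longleftrightarrow> x permutes {..<sum_list ps} \<and>
    (\<exists>css. map length css = ps \<and> arr css = [0..<sum_list ps] \<and> (\<forall>cs\<in>set css. is_cycle x cs))"

lemma is_canon_unique:
  assumes "is_canon ps x" "is_canon ps y"
  shows "x = y"
proof
  fix a
  obtain css where x: "x permutes {..<sum_list ps}" "map length css = ps" "arr css = [0..<sum_list ps]"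
    "\<forall>cs\<in>set css. is_cycle x cs" using assms(1) by (auto simp: is_canon_def)
  obtain css' where y: "y permutes {..<sum_list ps}" "map length css' = ps" "arr css' = [0..<sum_list ps]"
    "\<forall>cs\<in>set css'. is_cycle y cs" using assms(2) by (auto simp: is_canon_def)
  have "css' = css" using x y by (intro arr_inject) auto
  show "x a = y a"
  proof (cases "a < sum_list ps")
    case True
    then have "a \<in> set (arr css)" using x by simp
    then obtain cs where cs: "cs \<in> set css" "a \<in> set cs" by (auto simp: set_arr)
    have "map x cs = map y cs" using x(4) y(4) cs \<open>css' = css\<close> by (auto simp: is_cycle_def)
    then show ?thesis using cs by (metis map_eq_conv)
  next
    case False
    then show ?thesis using permutes_not_in[OF x(1), of a] permutes_not_in[OF y(1), of a] by simp
  qed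
qed

lemma arr_length: "length (arr css) = sum_list (map length css)"
  by (induction css) (simp_all add: length_wrap)

text \<open>Sending each entry of the arrangement to its position turns the list into
  \<open>[0..<n]\<close> and carries the cycles of \<sigma> to those of the relabelled permutation,
  without changing how they are nested.\<close>

lemma is_canon_relabel:
  assumes \<sigma>: "\<sigma> permutes {..<n}" "\<forall>cs\<in>set css. is_cycle \<sigma> cs" and m: "mset (arr css) = mset [0..<n]"
  shows "is_canon (map length css) (relabel \<sigma> (arr css))"
proof -
  let ?L = "arr css"
  have n: "n = sum_list (map length css)" using mset_eq_length[OF m] by (simp add: arr_length)
  have l: "labelling ?L permutes {..<n}" by (rule labelling_permutes[OF m])
  let ?i = "inv (labelling ?L)"
  have il: "?i (labelling ?L x) = x" "labelling ?L (?i x) = x" for x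
    using permutes_inverses[OF l] by auto
  have "map ?i ?L = map ?i (map (labelling ?L) [0..<length ?L])" by (simp only: map_labelling)
  also have "\<dots> = [0..<n]" by (simp add: il n arr_length comp_def)
  finally have "arr (map (map ?i) css) = [0..<n]" by (simp add: arr_map)
  moreover have "is_cycle (relabel \<sigma> ?L) (map ?i cs)" if cs: "cs \<in> set css" for cs
  proof -
    have c: "is_cycle \<sigma> cs" using \<sigma>(2) cs by blast
    have "inj ?i" using permutes_inj[OF permutes_inv[OF l]] .
    then have d: "distinct (map ?i cs)" using c by (auto simp: is_cycle_def distinct_map inj_on_def inj_def)
    have "map (relabel \<sigma> ?L) (map ?i cs) = map ?i (map \<sigma> cs)"
      by (simp add: relabel_def il)
    also have "\<dots> = rotate1 (map ?i cs)" using c by (metis is_cycle_def rotate1_map)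
    finally show ?thesis using d c by (simp add: is_cycle_def del: map_map)
  qed
  moreover have "relabel \<sigma> ?L permutes {..<n}" by (rule relabel_permutes[OF m \<sigma>(1)])
  ultimately show ?thesis
    unfolding is_canon_def n[symmetric] by (intro conjI exI[of _ "map (map ?i) css"]) auto
qed

lemma ex_is_canon:
  assumes "0 \<notin> set ps"
  shows "\<exists>x. is_canon ps x"
proof -
  obtain css where css: "map length css = ps" "arr css = [0..<sum_list ps]"
    using arr_surj[of "[0..<sum_list ps]" ps] by auto
  have "distinct (concat css)"
    using mset_arr[of css] css(2) by (metis distinct_upt mset_eq_imp_distinct_iff)
  moreover have "[] \<notin> set css" using assms css(1) by force
  ultimately obtain \<sigma> where "\<sigma> permutes set (concat css)" "\<forall>cs\<in>set css. is_cycle \<sigma> cs"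
    using ex_permutes_cycles by blast
  moreover have "set (concat css) = {..<sum_list ps}"
    using mset_arr[of css] css(2) by (metis atLeast0LessThan mset_eq_setD set_upt)
  ultimately show ?thesis using css by (auto simp: is_canon_def)
qed

definition canon :: "nat list \<Rightarrow> nat \<Rightarrow> nat"
  where "canon ps = (THE x. is_canon ps x)"

lemma canon_eq: "is_canon ps x \<Longrightarrow> canon ps = x"
  unfolding canon_def using is_canon_unique by blast

lemma valid_pos: "valid ps \<Longrightarrow> 0 \<notin> set ps"
  by (induction ps) auto

lemma is_canon_canon: "valid ps \<Longrightarrow> is_canon ps (canon ps)"
  using ex_is_canon[OF valid_pos] canon_eq by metis

definition valid_lists :: "nat \<Rightarrow> nat list set"
  where "valid_lists n = {ps. valid ps \<and> sum_list ps = n}"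

lemma canon_permutes: "ps \<in> valid_lists n \<Longrightarrow> canon ps permutes {..<n}"
  using is_canon_canon[of ps] by (auto simp: is_canon_def valid_lists_def)

text \<open>With the labels \<open>[0..<n]\<close>, relabelling returns \<open>x\<close> itself, so
  sorting the labels is a chain of conjugation steps that starts at \<open>x\<close>.\<close>

lemma conj_steps_to_canon:
  assumes x: "x permutes {..<n}"
  shows "\<exists>ps\<in>valid_lists n. (conj_step n)\<^sup>*\<^sup>* x (canon ps)"
proof -
  have "permutation x" using x by (auto simp: permutation_permutes)
  moreover have "x ` set [0..<n] = set [0..<n]" using permutes_image[OF x] by (simp add: atLeast0LessThan)
  ultimately obtain css where css: "(swap_step x)\<^sup>*\<^sup>* [0..<n] (arr css)" "\<forall>cs\<in>set css. is_cycle x cs"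
      "valid (map length css)"
    using swap_steps_to_arr[of x "[0..<n]"] by auto
  have m: "mset (arr css) = mset [0..<n]" by (rule swap_steps_mset[OF css(1)])
  have "canon (map length css) = relabel x (arr css)"
    by (rule canon_eq[OF is_canon_relabel[OF x css(2) m]])
  moreover have "(conj_step n)\<^sup>*\<^sup>* x (relabel x (arr css))"
    using conj_steps_relabel[OF css(1) _ x] by (simp add: relabel_upt)
  moreover have "map length css \<in> valid_lists n"
    using css(3) mset_eq_length[OF m] by (simp add: valid_lists_def arr_length)
  ultimately show ?thesis by metis
qed

section \<open>End blocks that are exchanged\<close>

definition block_swaps :: "('a \<Rightarrow> 'a) \<Rightarrow> 'a list \<Rightarrow> nat set"
  where "block_swaps x L = {k. 2 * k \<le> length L \<and>
    x ` set (take k L) = set (drop (length L - k) L) \<and>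
    x ` set (drop (length L - k) L) = set (take k L)}"

text \<open>The partial sums \<open>0\<close>, \<open>p1 / 2\<close>,
  \<open>p1 / 2 + p2 / 2\<close>, ... over the initial run of even parts: unions of outermost even
  cycles give the exchanged end blocks.\<close>

fun half_sums :: "nat list \<Rightarrow> nat set" where
  "half_sums [] = {0}"
| "half_sums (p # ps) = insert 0 (if even p then (\<lambda>k. k + p div 2) ` half_sums ps else {})"

lemma length_lows_highs: "length (lows cs) = (length cs + 1) div 2" "length (highs cs) = length cs div 2"
  by (induction cs) (auto simp: lows_Cons highs_Cons)

lemma distinct_lows_highs: "distinct cs \<Longrightarrow> distinct (lows cs) \<and> distinct (highs cs) \<and> set (lows cs) \<inter> set (highs cs) = {}"
  using distinct_wrap[of cs "[]"] by (auto simp: wrap_def)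

lemma zero_in_block_swaps: "0 \<in> block_swaps x L"
  by (simp add: block_swaps_def)

text \<open>For \<open>k > 0\<close> the first entry of the cycle lies in the low block, so the
  cycle alternates between the two blocks. With odd length its last and first entries would both be
  in the low block, which is absurd. With even length all low entries are in the low block, so at
  least half the cycle length is used up, and removing the cycle leaves exchanged blocks of
  \<open>M\<close>.\<close>

lemma block_swaps_wrap:
  assumes c: "is_cycle x cs" and inj: "inj x" and d: "distinct (wrap cs M)"
  shows "block_swaps x (wrap cs M) =
    insert 0 (if even (length cs) then (\<lambda>k. k + length cs div 2) ` block_swaps x M else {})"
proof -
  let ?W = "wrap cs M" and ?p = "length cs" and ?h = "length cs div 2"
  have ne: "cs \<noteq> []" using c by (simp add: is_cycle_def)
  have dist: "distinct cs" "distinct M" "set cs \<inter> set M = {}" using d by (simp_all add: distinct_wrap)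
  have lW: "length ?W = ?p + length M" by (rule length_wrap)
  have W: "?W = lows cs @ M @ rev (highs cs)" by (simp add: wrap_def)
  have odd_case: "odd ?p \<Longrightarrow> k = 0"
    and even_case: "k \<noteq> 0 \<Longrightarrow> ?h \<le> k" if k: "k \<in> block_swaps x ?W" for k
  proof -
    let ?A = "set (take k ?W)" and ?B = "set (drop (length ?W - k) ?W)"
    have k2: "2 * k \<le> length ?W" "x ` ?A = ?B" "x ` ?B = ?A" using k by (auto simp: block_swaps_def)
    have disj: "?A \<inter> ?B = {}" using k2(1) d by (intro set_take_disj_set_drop_if_distinct) auto
    have alt: "(even i \<longrightarrow> cs ! i \<in> ?A) \<and> (odd i \<longrightarrow> cs ! i \<in> ?B)" if "i < ?p" "k \<noteq> 0" for i
      using that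
    proof (induction i)
      case 0
      have "take k ?W = cs ! 0 # take (k - 1) (tl ?W)"
        using ne 0 by (cases cs; cases k) (auto simp: wrap_def lows_Cons)
      then show ?case by simp
    next
      case (Suc i)
      then have "cs ! Suc i = x (cs ! i)" using is_cycle_Suc[OF c, of i] by simp
      then show ?case using Suc k2 by auto
    qed
    show "k = 0" if "odd ?p"
    proof (rule ccontr)
      assume k0: "k \<noteq> 0"
      then have "cs ! (?p - 1) \<in> ?A" "cs ! 0 \<in> ?A" using alt[of "?p - 1"] alt[of 0] that ne by auto
      moreover have "x (cs ! (?p - 1)) = cs ! 0" using ne by (intro is_cycle_last[OF c]) simp
      ultimately have "cs ! 0 \<in> ?A \<inter> ?B" using k2 by (metis IntI imageI)
      then show False using disj by simp
    qed
    show "?h \<le> k" if "k \<noteq> 0"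
    proof -
      have "set (lows cs) \<subseteq> ?A" using alt that by (auto simp: set_lows)
      then have "card (set (lows cs)) \<le> card ?A" by (intro card_mono) auto
      also have "\<dots> \<le> k" using card_length[of "take k ?W"] by simp
      finally show ?thesis
        using dist distinct_lows_highs[of cs] by (simp add: distinct_card length_lows_highs)
    qed
  qed
  show ?thesis
  proof (cases "even ?p")
    case False
    then show ?thesis using odd_case zero_in_block_swaps[of x ?W] by auto
  next
    case True
    note ev = is_cycle_even[OF c True]
    have ll: "length (lows cs) = ?h" "length (highs cs) = ?h" "?p = 2 * ?h"
      using True by (auto simp: length_lows_highs)
    have lh: "set (lows cs) \<inter> set (highs cs) = {}" "set (lows cs) \<subseteq> set cs" "set (highs cs) \<subseteq> set cs"
      using distinct_lows_highs[of cs] dist set_lows_highs[of cs] by auto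
    have swap_sets: "A' = B \<and> B' = A"
      if "A' \<subseteq> B" "B' \<subseteq> A" "A' \<union> B' = A \<union> B" "A \<inter> B = {}" for A B A' B' :: "'a set"
      using that by blast
    have sub: "x ` set (lows cs) \<subseteq> set (highs cs)" "x ` set (highs cs) \<subseteq> set (lows cs)"
      using ev by auto
    moreover have "x ` set (lows cs) \<union> x ` set (highs cs) = set (lows cs) \<union> set (highs cs)"
      using is_cycle_image[OF c] set_lows_highs[of cs] by (metis image_Un)
    ultimately have xl: "x ` set (lows cs) = set (highs cs)" "x ` set (highs cs) = set (lows cs)"
      using lh(1) swap_sets by metis+
    \<comment> \<open>\<open>x\<close> exchanges the low and the high entries of \<open>cs\<close>,
      which are disjoint from the blocks of \<open>M\<close>; cancelling them on both sides leaves
      the condition on \<open>M\<close>.\<close>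
    have key: "k + ?h \<in> block_swaps x ?W \<longleftrightarrow> k \<in> block_swaps x M" for k
    proof (cases "2 * k \<le> length M")
      case False
      then show ?thesis using ll by (simp add: block_swaps_def lW)
    next
      case k: True
      let ?A = "set (take k M)" and ?B = "set (drop (length M - k) M)"
      have t: "set (take (k + ?h) ?W) = set (lows cs) \<union> ?A"
        using k ll by (simp add: W)
      have "drop (?h + j) ?W = drop j M @ rev (highs cs)" if "j \<le> length M" for j
        using that ll by (simp add: W)
      moreover have "length ?W - (k + ?h) = ?h + (length M - k)" using k ll by (simp add: lW)
      ultimately have "drop (length ?W - (k + ?h)) ?W = drop (length M - k) M @ rev (highs cs)"
        by (metis diff_le_self)
      then have dr: "set (drop (length ?W - (k + ?h)) ?W) = set (highs cs) \<union> ?B"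
        by (simp only: set_append set_rev Un_commute)
      have AB: "?A \<subseteq> set M" "?B \<subseteq> set M" by (auto dest: in_set_takeD in_set_dropD)
      then have dj: "set (lows cs) \<inter> ?A = {}" "set (highs cs) \<inter> ?B = {}" "set (highs cs) \<inter> ?A = {}" "set (lows cs) \<inter> ?B = {}"
        using dist(3) lh by auto
      have xd: "set (highs cs) \<inter> x ` ?A = {}" "set (lows cs) \<inter> x ` ?B = {}"
        using dj(1,2) inj xl by (metis image_Int image_empty)+
      have cancel: "X \<union> Y = X \<union> Z \<longleftrightarrow> Y = Z" if "X \<inter> Y = {}" "X \<inter> Z = {}" for X Y Z :: "'a set"
        using that by blast
      have "x ` (set (lows cs) \<union> ?A) = set (highs cs) \<union> ?B \<longleftrightarrow> x ` ?A = ?B"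
        unfolding image_Un xl by (rule cancel[OF xd(1) dj(2)])
      moreover have "x ` (set (highs cs) \<union> ?B) = set (lows cs) \<union> ?A \<longleftrightarrow> x ` ?B = ?A"
        unfolding image_Un xl by (rule cancel[OF xd(2) dj(1)])
      ultimately show ?thesis
        unfolding block_swaps_def mem_Collect_eq t dr using k ll by (simp add: lW)
    qed
    show ?thesis
    proof (intro equalityI subsetI)
      fix k assume k: "k \<in> block_swaps x ?W"
      show "k \<in> insert 0 (if even ?p then (\<lambda>k. k + ?h) ` block_swaps x M else {})"
      proof (cases "k = 0")
        case False
        then have "k = (k - ?h) + ?h" using even_case[OF k] by simp
        then show ?thesis using key[of "k - ?h"] k True by auto
      qed simp
    next
      fix k assume "k \<in> insert 0 (if even ?p then (\<lambda>k. k + ?h) ` block_swaps x M else {})"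
      then show "k \<in> block_swaps x ?W" using key True zero_in_block_swaps by auto
    qed
  qed
qed

lemma block_swaps_arr:
  assumes "inj x" "\<forall>cs\<in>set css. is_cycle x cs" "distinct (arr css)"
  shows "block_swaps x (arr css) = half_sums (map length css)"
  using assms
proof (induction css)
  case (Cons cs css)
  then show ?case using block_swaps_wrap[of x cs "arr css"] by (simp add: distinct_wrap)
qed (auto simp: block_swaps_def)

lemma block_swaps_canon:
  assumes "ps \<in> valid_lists n"
  shows "block_swaps (canon ps) [0..<n] = half_sums ps"
proof -
  have "is_canon ps (canon ps)" "sum_list ps = n"
    using assms is_canon_canon by (auto simp: valid_lists_def)
  then obtain css where "map length css = ps" "arr css = [0..<n]" "\<forall>cs\<in>set css. is_cycle (canon ps) cs"
    by (auto simp: is_canon_def)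
  then show ?thesis
    using block_swaps_arr[of "canon ps" css] permutes_inj[OF canon_permutes[OF assms]]
    by (metis distinct_upt)
qed

lemma block_swaps_upt:
  "k \<in> block_swaps x [0..<n] \<longleftrightarrow> 2 * k \<le> n \<and> x ` {..<k} = {n - k..<n} \<and> x ` {n - k..<n} = {..<k}"
  by (auto simp: block_swaps_def atLeast0LessThan)

text \<open>
  A transposition that would break a swapped pair of end blocks has a descent on both sides,
  hence lowers the length and is not a step.
\<close>

lemma block_swaps_not_step:
  assumes x: "x permutes {..<n}" and k: "2 * k \<le> n" "x ` {..<k} = {n - k..<n}" "x ` {n - k..<n} = {..<k}"
    and i: "Suc i < n" "Suc i = k \<or> Suc i = n - k"
  shows "x (Suc i) < x i"
proof -
  have inj: "inj x" using x by (rule permutes_inj)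
  have low: "x a \<in> {n - k..<n} \<longleftrightarrow> a < k" for a
    using k(2) inj by (metis inj_image_mem_iff lessThan_iff)
  have high: "x a < k \<longleftrightarrow> a \<in> {n - k..<n}" for a
    using k(3) inj by (metis inj_image_mem_iff lessThan_iff)
  have "x (Suc i) < n" using permutes_less[OF x i(1)] .
  show ?thesis
    using i(2)
  proof
    assume "Suc i = k"
    then show ?thesis using low[of i] low[of "Suc i"] \<open>x (Suc i) < n\<close> by auto
  next
    assume "Suc i = n - k"
    then show ?thesis using high[of i] high[of "Suc i"] i(1) by auto
  qed
qed

text \<open>\<open>adj i\<close> maps both end blocks to themselves unless it straddles the edge of
  one of them. There both \<open>x\<close> and its inverse have a descent, so no step is
  possible.\<close>

lemma block_swaps_mono_step:
  assumes "conj_step n x y" "k \<in> block_swaps x [0..<n]"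
  shows "k \<in> block_swaps y [0..<n]"
proof -
  obtain i where i: "Suc i < n" "x i < x (Suc i) \<or> inv x i < inv x (Suc i)"
      "y = adj i \<circ> x \<circ> adj i" and x: "x permutes {..<n}"
    using assms(1) by (auto simp: conj_step_def)
  have k: "2 * k \<le> n" "x ` {..<k} = {n - k..<n}" "x ` {n - k..<n} = {..<k}"
    using assms(2) by (auto simp: block_swaps_upt)
  have k': "inv x ` {..<k} = {n - k..<n}" "inv x ` {n - k..<n} = {..<k}"
    using k permutes_inj[OF x] by (metis image_inv_f_f)+
  have "Suc i \<noteq> k" "Suc i \<noteq> n - k"
    using block_swaps_not_step[OF x k i(1)]
      block_swaps_not_step[OF permutes_inv[OF x] k(1) k' i(1)] i(2) by auto
  then have "adj i ` {..<k} = {..<k}" "adj i ` {n - k..<n} = {n - k..<n}"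
    using i(1) by (auto intro!: transpose_image_eq)
  then have "y ` {..<k} = {n - k..<n}" "y ` {n - k..<n} = {..<k}"
    using k by (metis i(3) image_comp)+
  then show ?thesis using k(1) by (simp add: block_swaps_upt)
qed

lemma block_swaps_mono:
  "(conj_step n)\<^sup>*\<^sup>* x y \<Longrightarrow> block_swaps x [0..<n] \<subseteq> block_swaps y [0..<n]"
  by (induction rule: rtranclp_induct) (auto dest: block_swaps_mono_step)

section \<open>The cycle type\<close>

definition period_card :: "nat \<Rightarrow> (nat \<Rightarrow> nat) \<Rightarrow> nat \<Rightarrow> nat"
  where "period_card n x p = card {a \<in> {..<n}. least_power x a = p}"

lemma period_card_step:
  assumes "conj_step n x y"
  shows "period_card n y p = period_card n x p"
proof -
  obtain i where i: "Suc i < n" "y = adj i \<circ> x \<circ> adj i" using assms by (auto simp: conj_step_def)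
  have "(y ^^ k) a = adj i ((x ^^ k) (adj i a))" for k a
    by (induction k) (auto simp: i(2))
  then have lp: "least_power y a = least_power x (adj i a)" for a
    unfolding least_power_def by (metis transpose_involutory)
  have lt: "adj i a < n \<longleftrightarrow> a < n" for a using i(1) by (auto simp: transpose_def)
  have "bij_betw (adj i) {a \<in> {..<n}. least_power y a = p} {a \<in> {..<n}. least_power x a = p}"
    by (rule bij_betw_byWitness[of _ "adj i"]) (auto simp: lp lt)
  then show ?thesis unfolding period_card_def by (rule bij_betw_same_card)
qed

lemma period_card_steps: "(conj_step n)\<^sup>*\<^sup>* x y \<Longrightarrow> period_card n y p = period_card n x p"
proof (induction rule: rtranclp_induct)
  case (step y z)
  then show ?case using period_card_step[OF step.hyps(2), of p] by simp
qed simp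

text \<open>Each cycle of length \<open>p\<close> contributes \<open>p\<close> points. Counting
  points instead of cycles makes invariance under conjugation a plain bijection.\<close>

lemma period_card_canon:
  assumes "ps \<in> valid_lists n"
  shows "period_card n (canon ps) p = p * count (mset ps) p"
proof -
  have "is_canon ps (canon ps)" "sum_list ps = n"
    using assms is_canon_canon by (auto simp: valid_lists_def)
  then obtain css where css: "map length css = ps" "arr css = [0..<n]" "\<forall>cs\<in>set css. is_cycle (canon ps) cs"
    by (auto simp: is_canon_def)
  let ?P = "\<lambda>a. least_power (canon ps) a = p"
  have m: "mset (concat css) = mset [0..<n]" using mset_arr[of css] css(2) by simp
  then have "distinct (concat css)" "set (concat css) = {..<n}"
    using mset_eq_imp_distinct_iff[OF m] mset_eq_setD[OF m] by (simp_all add: atLeast0LessThan)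
  then have "period_card n (canon ps) p = card (set (filter ?P (concat css)))"
    by (simp add: period_card_def)
  also have "\<dots> = length (filter ?P (concat css))"
    using \<open>distinct (concat css)\<close> by (intro distinct_card) simp
  also have "\<dots> = p * count (mset (map length css)) p"
    using css(3)
  proof (induction css)
    case (Cons cs css)
    have "least_power (canon ps) a = length cs" if "a \<in> set cs" for a
      using that Cons.prems by (intro least_power_is_cycle) auto
    then have "filter ?P cs = (if length cs = p then cs else [])"
      by (auto simp: filter_empty_conv)
    then show ?case using Cons by simp
  qed simp
  finally show ?thesis by (simp add: css)
qed

section \<open>Recovering the list of lengths\<close>

lemma finite_half_sums: "finite (half_sums ps)"
  by (induction ps) auto

lemma half_sums_odd: "\<forall>q\<in>set ps. odd q \<Longrightarrow> half_sums ps = {0}"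
  by (cases ps) auto

text \<open>In a valid list the even parts come before the odd ones, and each of them, being
  positive, adds one new partial sum to the initial 0.\<close>

lemma card_half_sums: "valid ps \<Longrightarrow> card (half_sums ps) = Suc (length (filter even ps))"
proof (induction ps)
  case (Cons p ps)
  show ?case
  proof (cases "even p")
    case True
    have "0 \<notin> (\<lambda>k. k + p div 2) ` half_sums ps" using Cons.prems True by auto
    moreover have "card ((\<lambda>k. k + p div 2) ` half_sums ps) = card (half_sums ps)"
      by (intro card_image) (simp add: inj_on_def)
    ultimately show ?thesis using Cons True by (simp add: finite_half_sums)
  next
    case False
    then have "\<forall>q\<in>set (p # ps). odd q" using Cons.prems by auto
    then show ?thesis by (simp only: half_sums_odd) (auto simp: filter_empty_conv)
  qed
qed simp

text \<open>If the first part is even, the least nonzero element of the set is half of it;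
  subtracting it leaves the set of the tail. Once the first part is odd, all parts are odd and
  descending, so the multiset determines the list.\<close>

lemma half_sums_inject:
  assumes "valid ps" "valid qs" "mset ps = mset qs" "half_sums ps = half_sums qs"
  shows "ps = qs"
  using assms
proof (induction ps arbitrary: qs)
  case (Cons p ps)
  then obtain q qs' where qs: "qs = q # qs'" by (cases qs) auto
  have lower: "r div 2 \<le> k" if "k \<in> half_sums (r # rs)" "k \<noteq> 0" for k r rs
    using that by (auto split: if_splits)
  have zero: "0 \<in> half_sums rs" for rs by (cases rs) auto
  have upper: "r div 2 \<in> half_sums (r # rs)" if "even r" for r rs
    using that zero[of rs] by force
  have ev: "even p \<longleftrightarrow> even q"
  proof -
    \<comment> \<open>Whether the first part is even is visible in the set: it is a singleton
      exactly for an odd first part.\<close>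
    have "card (half_sums (r # rs)) = 1 \<longleftrightarrow> odd r" if "valid (r # rs)" for r rs
      using card_half_sums[OF that] that by (auto simp: filter_empty_conv)
    then show ?thesis using Cons.prems qs by metis
  qed
  have pq: "p = q \<and> half_sums ps = half_sums qs'"
  proof (cases "even p")
    case True
    then have "p div 2 \<noteq> 0" "q div 2 \<noteq> 0" using ev Cons.prems qs by auto
    moreover have "p div 2 \<in> half_sums (q # qs')" "q div 2 \<in> half_sums (p # ps)"
      using upper True ev Cons.prems(4) qs by metis+
    ultimately have "p div 2 = q div 2" using lower by (metis order_antisym)
    then have "p = q" using True ev by (metis dvd_mult_div_cancel)
    have "0 \<notin> (\<lambda>k. k + r div 2) ` half_sums rs" if "r div 2 \<noteq> 0" for r rs
      using that by auto
    then have "(\<lambda>k. k + p div 2) ` half_sums ps = (\<lambda>k. k + p div 2) ` half_sums qs'"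
      using Cons.prems(4) True \<open>p div 2 \<noteq> 0\<close> unfolding qs \<open>p = q\<close> by (simp add: insert_ident)
    then have "half_sums ps = half_sums qs'" by (subst (asm) inj_image_eq_iff) (auto simp: inj_def)
    with \<open>p = q\<close> show ?thesis ..
  next
    case False
    then have p: "\<forall>r\<in>set ps. odd r \<and> r \<le> p" "\<forall>r\<in>set qs'. odd r \<and> r \<le> q"
      using Cons.prems ev qs by auto
    have "q \<in> set (p # ps)" "p \<in> set (q # qs')"
      using Cons.prems(3) qs by (metis list.set_intros(1) mset_eq_setD)+
    then have "p = q" using p by (auto intro: order_antisym)
    then show ?thesis using p by (simp add: half_sums_odd)
  qed
  then have "ps = qs'" using Cons.prems qs by (intro Cons.IH) auto
  then show ?case using pq qs by simp
qed simp

lemma canon_steps_canon: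
  assumes ps: "ps \<in> valid_lists n" and qs: "qs \<in> valid_lists n"
    and steps: "(conj_step n)\<^sup>*\<^sup>* (canon ps) (canon qs)"
  shows "ps = qs"
proof (rule half_sums_inject)
  show v: "valid ps" "valid qs" using ps qs by (auto simp: valid_lists_def)
  show m: "mset ps = mset qs"
  proof (rule multiset_eqI)
    fix p
    have "p * count (mset ps) p = p * count (mset qs) p"
      by (metis period_card_steps[OF steps] period_card_canon[OF ps] period_card_canon[OF qs])
    \<comment> \<open>At \<open>p = 0\<close> the factor \<open>p\<close> cannot be cancelled, but 0
      occurs in neither list.\<close>
    then show "count (mset ps) p = count (mset qs) p"
      using valid_pos[OF v(1)] valid_pos[OF v(2)]
      by (cases "p = 0") (metis not_in_iff set_mset_mset, simp)
  qed
  have "half_sums ps \<subseteq> half_sums qs"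
    using block_swaps_mono[OF steps] ps qs by (simp add: block_swaps_canon)
  moreover have "card (half_sums ps) = card (half_sums qs)"
    using m v by (metis card_half_sums mset_filter size_mset)
  ultimately show "half_sums ps = half_sums qs"
    by (intro card_subset_eq finite_half_sums)
qed

section \<open>Central coefficient functions and their number\<close>

text \<open>As lengths never decrease along steps, all intermediate permutations have the same
  length too, and the chain can be reversed. So this is a class of an equivalence relation although
  it is written as a set of reachable permutations.\<close>

definition canon_class :: "nat \<Rightarrow> nat list \<Rightarrow> (nat \<Rightarrow> nat) set"
  where "canon_class n ps = {x. (conj_step n)\<^sup>*\<^sup>* (canon ps) x \<and> len x = len (canon ps)}"

definition central_coeffs :: "nat \<Rightarrow> ((nat \<Rightarrow> nat) \<Rightarrow> 'k::zero) \<Rightarrow> bool"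
  where "central_coeffs n c \<longleftrightarrow>
    (\<forall>x y. conj_step n x y \<longrightarrow> (if len y = len x then c x = c y else c x = 0))"

lemma canon_in_class: "canon ps \<in> canon_class n ps"
  by (simp add: canon_class_def)

lemma canon_class_unique:
  assumes "ps \<in> valid_lists n" "qs \<in> valid_lists n" "x \<in> canon_class n ps"
    "(conj_step n)\<^sup>*\<^sup>* x (canon qs)"
  shows "ps = qs"
  using assms(3,4) by (intro canon_steps_canon[OF assms(1,2)]) (auto simp: canon_class_def)

lemma canon_class_disjoint:
  assumes "ps \<in> valid_lists n" "qs \<in> valid_lists n" "x \<in> canon_class n ps" "x \<in> canon_class n qs"
  shows "ps = qs"
proof (rule canon_class_unique[OF assms(1-3)])
  show "(conj_step n)\<^sup>*\<^sup>* x (canon qs)"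
    using conj_steps_sym[of n "canon qs" x] assms(4) by (simp add: canon_class_def)
qed

text \<open>Suppose a step leads from the class to a longer \<open>y\<close>. Then \<open>y\<close>
  reaches some canonical permutation, which is reachable from \<open>canon ps\<close> and hence
  equal to it; so \<open>y\<close> is at most as long as the class, a contradiction. No length
  formula for canonical permutations is needed.\<close>

lemma central_coeffs_class:
  assumes ps: "ps \<in> valid_lists n"
  shows "central_coeffs n (\<lambda>x. if x \<in> canon_class n ps then a else 0)"
  unfolding central_coeffs_def
proof (intro allI impI)
  fix x y assume step: "conj_step n x y"
  show "if len y = len x then (if x \<in> canon_class n ps then a else 0) = (if y \<in> canon_class n ps then a else 0)
    else (if x \<in> canon_class n ps then a else 0) = 0"
  proof (cases "len y = len x")
    case True
    then have "x \<in> canon_class n ps \<longleftrightarrow> y \<in> canon_class n ps"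
      using step conj_step_sym[OF step] unfolding canon_class_def mem_Collect_eq
      by (metis rtranclp.rtrancl_into_rtrancl)
    then show ?thesis using True by simp
  next
    case False
    have "x \<notin> canon_class n ps"
    proof
      assume x: "x \<in> canon_class n ps"
      have "y permutes {..<n}" by (rule conj_step_permutes[OF step])
      then obtain qs where qs: "qs \<in> valid_lists n" "(conj_step n)\<^sup>*\<^sup>* y (canon qs)"
        using conj_steps_to_canon by blast
      then have "ps = qs"
        using canon_class_unique[OF ps qs(1) x] step by (metis converse_rtranclp_into_rtranclp)
      then have "len y \<le> len x" using conj_steps_len[OF qs(2)] x by (simp add: canon_class_def)
      then show False using conj_step_len[OF step] False by simp
    qed
    then show ?thesis using False by simp
  qed
qed

text \<open>Along a chain the coefficient is constant up to the first lengthening step, where it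
  vanishes; if such a step occurs, the whole chain is lengthening.\<close>

lemma central_coeffs_steps:
  assumes "central_coeffs n c" "(conj_step n)\<^sup>*\<^sup>* x y"
  shows "if len y = len x then c x = c y else c x = 0"
  using assms(2)
proof (induction rule: converse_rtranclp_induct)
  case (step x z)
  have "if len z = len x then c x = c z else c x = 0"
    using assms(1) step.hyps(1) by (simp add: central_coeffs_def)
  moreover have "len x \<le> len z" "len z \<le> len y"
    using conj_step_len[OF step.hyps(1)] conj_steps_len[OF step.hyps(2)] .
  ultimately show ?case using step.IH by (auto split: if_splits)
qed simp

lemma length_le_sum_list: "valid ps \<Longrightarrow> length ps \<le> sum_list ps"
  by (induction ps) auto

lemma finite_valid_lists: "finite (valid_lists n)"
proof (rule finite_subset)
  show "valid_lists n \<subseteq> {xs. set xs \<subseteq> {..n} \<and> length xs \<le> n}"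
    using length_le_sum_list member_le_sum_list by (fastforce simp: valid_lists_def)
qed (simp add: finite_lists_length_le)

text \<open>Let \<open>x\<close> reach \<open>canon qs\<close>. At equal length \<open>x\<close>
  belongs to that class alone and shares its coefficient; otherwise \<open>c x = 0\<close> and
  \<open>x\<close> lies in no class.\<close>

lemma central_coeffs_expand:
  fixes c :: "(nat \<Rightarrow> nat) \<Rightarrow> 'k::comm_monoid_add"
  assumes c: "central_coeffs n c" and x: "x permutes {..<n}"
  shows "c x = (\<Sum>ps\<in>valid_lists n. if x \<in> canon_class n ps then c (canon ps) else 0)"
proof -
  obtain qs where qs: "qs \<in> valid_lists n" "(conj_step n)\<^sup>*\<^sup>* x (canon qs)"
    using conj_steps_to_canon[OF x] by blast
  have cx: "if len (canon qs) = len x then c x = c (canon qs) else c x = 0"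
    by (rule central_coeffs_steps[OF c qs(2)])
  have "x \<in> canon_class n ps \<longleftrightarrow> len (canon qs) = len x \<and> ps = qs" if ps: "ps \<in> valid_lists n" for ps
  proof
    assume "x \<in> canon_class n ps"
    moreover from this have "ps = qs" using canon_class_unique[OF ps qs(1)] qs(2) by blast
    ultimately show "len (canon qs) = len x \<and> ps = qs" by (simp add: canon_class_def)
  qed (use conj_steps_sym[OF qs(2)] in \<open>auto simp: canon_class_def\<close>)
  then have "(\<Sum>ps\<in>valid_lists n. if x \<in> canon_class n ps then c (canon ps) else 0) =
    (\<Sum>ps\<in>valid_lists n. if ps = qs then c x else 0)"
    using cx by (intro sum.cong) (auto split: if_splits)
  also have "\<dots> = c x" using qs(1) finite_valid_lists by simp
  finally show ?thesis by simp
qed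

section \<open>Counting the valid lists\<close>

lemma valid_odd: "valid ps \<Longrightarrow> \<forall>q\<in>set ps. odd q \<Longrightarrow> sorted (rev ps)"
  by (induction ps) (auto simp: sorted_append)

lemma valid_append_iff:
  "\<forall>p\<in>set es. even p \<Longrightarrow> valid (es @ os) \<longleftrightarrow> 0 \<notin> set es \<and> valid os"
  by (induction es) auto

lemma valid_odd_rev: "sorted os \<Longrightarrow> \<forall>q\<in>set os. odd q \<Longrightarrow> valid (rev os)"
proof (induction os rule: rev_induct)
  case (snoc q os)
  then show ?case by (auto simp: sorted_append odd_pos)
qed simp

lemma valid_decompose:
  "valid ps \<Longrightarrow> ps = filter even ps @ rev (sorted_list_of_multiset (filter_mset odd (mset ps)))"
proof (induction ps)
  case (Cons p ps)
  show ?case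
  proof (cases "even p")
    case False
    then have o: "\<forall>q\<in>set (p # ps). odd q" using Cons.prems by auto
    then have "sorted (rev (p # ps))" using Cons.prems by (intro valid_odd)
    then have "sort (p # ps) = rev (p # ps)" by (intro properties_for_sort) auto
    moreover have "filter_mset odd (mset (p # ps)) = mset (p # ps)"
      using o by (simp add: filter_mset_eq_conv)
    moreover have "filter even (p # ps) = []" using o by (simp add: filter_empty_conv)
    ultimately show ?thesis by (metis append_Nil rev_rev_ident sorted_list_of_multiset_mset)
  qed (use Cons in auto)
qed simp

text \<open>Appending the fixed descending tail of odd parts is inverse to
  \<open>filter even\<close>, so the valid lists correspond to the orderings of the even
  parts.\<close>

lemma card_valid_mset:
  assumes "0 \<notin># P"
  shows "card {ps. valid ps \<and> mset ps = P} = card (permutations_of_multiset (filter_mset even P))"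
proof (rule bij_betw_same_card[symmetric])
  let ?os = "rev (sorted_list_of_multiset (filter_mset odd P))"
  have mos: "mset ?os = filter_mset odd P" by simp
  have sos: "set ?os = {q. q \<in># P \<and> odd q}" using mos by (metis set_mset_filter set_mset_mset)
  have vos: "valid ?os"
    using sos by (intro valid_odd_rev) auto
  show "bij_betw (\<lambda>es. es @ ?os) (permutations_of_multiset (filter_mset even P)) {ps. valid ps \<and> mset ps = P}"
  proof (rule bij_betw_byWitness[of _ "filter even"])
    have ev: "(\<forall>p\<in>set es. even p) \<and> 0 \<notin> set es" if "mset es = filter_mset even P" for es
    proof -
      have "set es = {q. q \<in># P \<and> even q}" using that by (metis set_mset_filter set_mset_mset)
      then show ?thesis using assms by auto
    qed
    show "\<forall>es\<in>permutations_of_multiset (filter_mset even P). filter even (es @ ?os) = es"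
    proof
      fix es assume "es \<in> permutations_of_multiset (filter_mset even P)"
      then have "filter even es = es" using ev[of es] by (auto simp: permutations_of_multiset_def filter_id_conv)
      moreover have "filter even ?os = []" using sos by (auto simp: filter_empty_conv)
      ultimately show "filter even (es @ ?os) = es" by simp
    qed
    show "\<forall>ps\<in>{ps. valid ps \<and> mset ps = P}. filter even ps @ ?os = ps"
      using valid_decompose by auto
    show "(\<lambda>es. es @ ?os) ` permutations_of_multiset (filter_mset even P) \<subseteq> {ps. valid ps \<and> mset ps = P}"
    proof (intro image_subsetI)
      fix es assume "es \<in> permutations_of_multiset (filter_mset even P)"
      then have m: "mset es = filter_mset even P" by (simp add: permutations_of_multiset_def)
      then have "valid (es @ ?os)" using ev[OF m] vos by (simp add: valid_append_iff)
      moreover have "mset (es @ ?os) = P" using m multiset_partition[of P even] by simp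
      ultimately show "es @ ?os \<in> {ps. valid ps \<and> mset ps = P}" by simp
    qed
    show "filter even ` {ps. valid ps \<and> mset ps = P} \<subseteq> permutations_of_multiset (filter_mset even P)"
      by (auto simp: permutations_of_multiset_def)
  qed
qed

text \<open>Reindexing by \<open>x = 2 * j\<close> exhibits the product as the denominator of the
  multinomial coefficient that counts orderings of the even parts.\<close>

lemma even_mult_fact_eq:
  assumes "0 \<notin># P"
  shows "even_mult_fact P = (\<Prod>x\<in>set_mset (filter_mset even P). fact (count (filter_mset even P) x))"
  unfolding even_mult_fact_def
proof (rule prod.reindex_bij_betw[of "\<lambda>j. 2 * j", THEN trans, rotated])
  have "1 \<le> j" if "2 * j \<in># P" for j
    using that assms by (cases j) auto
  then  show "bij_betw (\<lambda>j. 2 * j) {j. 1 \<le> j \<and> 2 * j \<in># P} (set_mset (filter_mset even P))"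
    using assms by (intro bij_betw_byWitness[of _ "\<lambda>x. x div 2"]) (auto elim!: evenE)
qed auto

lemma card_valid_lists:
  "rat_of_nat (card (valid_lists n)) =
    (\<Sum>P\<in>partitions n. fact (num_even_parts P) / rat_of_nat (even_mult_fact P))"
proof -
  have eq: "valid_lists n = (\<Union>P\<in>partitions n. {ps. valid ps \<and> mset ps = P})"
    using valid_pos by (auto simp: valid_lists_def partitions_def sum_mset_sum_list)
  have "card (valid_lists n) = (\<Sum>P\<in>partitions n. card {ps. valid ps \<and> mset ps = P})"
    unfolding eq
  proof (rule card_UN_disjoint[OF finite_partitions])
    show "\<forall>P\<in>partitions n. finite {ps. valid ps \<and> mset ps = P}"
      by (intro ballI finite_subset[OF _ finite_valid_lists[of n]]) (auto simp: eq)
  qed auto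
  moreover have "rat_of_nat (card {ps. valid ps \<and> mset ps = P}) =
      fact (num_even_parts P) / rat_of_nat (even_mult_fact P)" if "P \<in> partitions n" for P
  proof -
    have P: "0 \<notin># P" using that by (simp add: partitions_def)
    let ?d = "even_mult_fact P"
    have "card {ps. valid ps \<and> mset ps = P} * ?d = fact (num_even_parts P)"
      using card_permutations_of_multiset[of "filter_mset even P"]
      unfolding card_valid_mset[OF P] num_even_parts_def even_mult_fact_eq[OF P] by simp
    then have "rat_of_nat (card {ps. valid ps \<and> mset ps = P}) * rat_of_nat ?d = fact (num_even_parts P)"
      by (metis of_nat_fact of_nat_mult)
    moreover have "rat_of_nat ?d \<noteq> 0" by (simp add: even_mult_fact_eq[OF P])
    ultimately show ?thesis by (simp add: nonzero_eq_divide_eq)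
  qed
  ultimately show ?thesis by simp
qed

section \<open>The basis of the nilCoxeter algebra\<close>

definition wterm :: "'a list \<Rightarrow> 'k \<Rightarrow> 'a free_word \<Rightarrow>\<^sub>0 'k::field"
  where "wterm u c = Poly_Mapping.single (Word u) c"

abbreviation nc_free :: "nat \<Rightarrow> (nat free_word \<Rightarrow>\<^sub>0 'k::field) ring"
  where "nc_free n \<equiv> free_algebra {1..<n}"

lemma wterm_mult: "wterm u c * wterm v d = wterm (u @ v) (c * d)"
  by (simp add: wterm_def mult_single plus_free_word_def)

lemma wterm_add: "wterm u c + wterm u d = wterm u (c + d)"
  by (simp add: wterm_def single_add)

lemma wterm_Nil_one [simp]: "wterm [] 1 = 1"
  by (simp add: wterm_def flip: zero_free_word_def)

lemma wterm_zero [simp]: "wterm u 0 = 0"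
  by (simp add: wterm_def)

lemma wterm_scale: "wterm [] c * wterm u d = wterm u (c * d)"
  by (simp add: wterm_mult)

lemma gen_wterm: "gen i = wterm [i] 1"
  by (simp add: gen_def wterm_def)

lemma wterm_carrier: "set u \<subseteq> X \<Longrightarrow> wterm u c \<in> carrier (free_algebra X)"
  by (auto simp: wterm_def free_algebra_def)

lemma free_algebra_closed:
  assumes "f \<in> carrier (free_algebra X)" "g \<in> carrier (free_algebra X)"
  shows "f + g \<in> carrier (free_algebra X)" "f * g \<in> carrier (free_algebra X)"
    "f - g \<in> carrier (free_algebra X)"
proof -
  interpret ring "free_algebra X" by (rule free_algebra_ring)
  show "f + g \<in> carrier (free_algebra X)" "f * g \<in> carrier (free_algebra X)"
    using a_closed[OF assms] m_closed[OF assms] by (simp_all add: free_algebra_def)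
  show "f - g \<in> carrier (free_algebra X)"
    using assms by (auto simp: free_algebra_def dest!: subsetD[OF keys_diff])
qed

lemma free_algebra_sum_closed:
  "(\<And>a. a \<in> S \<Longrightarrow> f a \<in> carrier (free_algebra X)) \<Longrightarrow> sum f S \<in> carrier (free_algebra X)"
proof (induction S rule: infinite_finite_induct)
  case (insert x F)
  then show ?case by (auto intro: free_algebra_closed)
qed (auto simp: free_algebra_def)

lemma free_algebra_induct [consumes 1, case_names zero add wterm]:
  assumes f: "f \<in> carrier (free_algebra X)"
    and "P 0" "\<And>f g. P f \<Longrightarrow> P g \<Longrightarrow> P (f + g)" "\<And>u c. set u \<subseteq> X \<Longrightarrow> P (wterm u c)"
  shows "P f"
proof -
  have "(\<Sum>u\<in>Poly_Mapping.keys f. Poly_Mapping.single u (Poly_Mapping.lookup f u)) = f"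
    by (rule poly_mapping_eqI)
      (auto simp: lookup_sum lookup_single when_def in_keys_iff sum.delta')
  moreover have "P (\<Sum>u\<in>S. Poly_Mapping.single u (Poly_Mapping.lookup f u))"
    if "finite S" "S \<subseteq> Poly_Mapping.keys f" for S
    using that
  proof (induction S)
    case (insert u S)
    then have "set (letters u) \<subseteq> X" using f by (auto simp: free_algebra_def)
    then have "P (Poly_Mapping.single u (Poly_Mapping.lookup f u))"
      using assms(4)[of "letters u"] by (simp add: wterm_def)
    then show ?case using insert assms(3) by simp
  qed (simp add: assms(2))
  ultimately show ?thesis by (metis finite_keys order_refl)
qed

text \<open>Translates the ideal laws from the operations of the ring record to those of the type
  class, in which the later computations are done.\<close>

lemma nilcoxeter_ideal_closed:
  fixes f g :: "nat free_word \<Rightarrow>\<^sub>0 'k::field"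
  shows "0 \<in> (nilcoxeter_ideal n :: (nat free_word \<Rightarrow>\<^sub>0 'k) set)"
    and "f \<in> nilcoxeter_ideal n \<Longrightarrow> g \<in> nilcoxeter_ideal n \<Longrightarrow> f + g \<in> nilcoxeter_ideal n"
    and "f \<in> nilcoxeter_ideal n \<Longrightarrow> - f \<in> nilcoxeter_ideal n"
    and "f \<in> nilcoxeter_ideal n \<Longrightarrow> g \<in> carrier (nc_free n) \<Longrightarrow> g * f \<in> nilcoxeter_ideal n"
    and "f \<in> nilcoxeter_ideal n \<Longrightarrow> g \<in> carrier (nc_free n) \<Longrightarrow> f * g \<in> nilcoxeter_ideal n"
    and "f \<in> nilcoxeter_ideal n \<Longrightarrow> f \<in> carrier (nc_free n)"
proof -
  let ?A = "nc_free n :: (nat free_word \<Rightarrow>\<^sub>0 'k) ring"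
  interpret I: ideal "nilcoxeter_ideal n" ?A by (rule nilcoxeter_ideal_ideal)
  show "0 \<in> (nilcoxeter_ideal n :: (nat free_word \<Rightarrow>\<^sub>0 'k) set)"
    using additive_subgroup.zero_closed[OF I.is_additive_subgroup] by (simp add: free_algebra_def)
  show "f + g \<in> nilcoxeter_ideal n" if "f \<in> nilcoxeter_ideal n" "g \<in> nilcoxeter_ideal n"
    using additive_subgroup.a_closed[OF I.is_additive_subgroup that] by (simp add: free_algebra_def)
  show c: "f \<in> nilcoxeter_ideal n \<Longrightarrow> f \<in> carrier ?A" by (rule I.Icarr)
  show l: "g * f \<in> nilcoxeter_ideal n" if "f \<in> nilcoxeter_ideal n" "g \<in> carrier ?A" for g
    using I.I_l_closed[OF that] by (simp add: free_algebra_def)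
  show "f * g \<in> nilcoxeter_ideal n" if "f \<in> nilcoxeter_ideal n" "g \<in> carrier ?A"
    using I.I_r_closed[OF that] by (simp add: free_algebra_def)
  have "wterm [] (- 1) * f = - f"
    using wterm_add[of "[]" "1 :: 'k" "- 1"] by (metis add.right_inverse add_eq_0_iff mult_1 mult_minus_left wterm_Nil_one wterm_zero)
  then show "- f \<in> nilcoxeter_ideal n" if "f \<in> nilcoxeter_ideal n"
    using l[OF that, of "wterm [] (- 1)"] by (simp add: wterm_carrier)
qed

lemma nilcoxeter_relators_in_ideal: "nilcoxeter_relators n \<subseteq> nilcoxeter_ideal n"
  unfolding nilcoxeter_ideal_def
  using ring.genideal_self[OF free_algebra_ring nilcoxeter_relators_closed] .

text \<open>The generators are indexed from \<open>1\<close>, but permutations act on \<open>{0..<n}\<close>.\<close>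

definition word_perm :: "nat list \<Rightarrow> nat \<Rightarrow> nat"
  where "word_perm u = foldr (\<lambda>i w. adj (i - 1) \<circ> w) u id"

lemma word_perm_simps [simp]:
  "word_perm [] = id" "word_perm (i # u) = adj (i - 1) \<circ> word_perm u"
  "word_perm (u @ v) = word_perm u \<circ> word_perm v"
  by (simp add: word_perm_def, simp add: word_perm_def)
    (induction u, simp_all add: word_perm_def comp_assoc)

lemma word_perm_permutes: "set u \<subseteq> {1..<n} \<Longrightarrow> word_perm u permutes {..<n}"
proof (induction u)
  case (Cons i u)
  then show ?case unfolding word_perm_simps by (intro permutes_compose adj_permutes) auto
qed (simp add: permutes_id)

section \<open>Reduced words\<close>

lemma len_id [simp]: "len id = 0"
proof -
  have "invs id = {}" by (auto simp: invs_def)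
  then show ?thesis by (simp add: len_def)
qed

lemma len_word_perm: "set u \<subseteq> {1..<n} \<Longrightarrow> len (word_perm u) \<le> length u"
proof (induction u)
  case (Cons i u)
  then have "Suc (i - 1) < n" "len (word_perm u) \<le> length u" "set u \<subseteq> {1..<n}" by auto
  then show ?case
    using len_adj_comp_cases[OF word_perm_permutes[of u n], of "i - 1"]
    unfolding word_perm_simps list.size by linarith
qed simp

lemma ascending_permutes_id:
  assumes w: "w permutes {..<n::nat}" and "\<And>i. Suc i < n \<Longrightarrow> w i < w (Suc i)"
  shows "w = id"
proof (rule permutes_natset_ge[OF w])
  have "i \<le> w i" if "i < n" for i
    using that
  proof (induction i)
    case (Suc i)
    then show ?case using assms(2)[of i] by simp
  qed simp
  then show "\<forall>i\<in>{..<n}. i \<le> w i" by simp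
qed

lemma adj_adj_comp: "adj i \<circ> (adj i \<circ> w) = w"
  by (simp add: fun_eq_iff)

text \<open>Left descents are split off as first letters, each lowering the length by 1. When none
  is left, the inverse of \<open>w\<close> is increasing, hence the identity.\<close>

lemma ex_reduced_word:
  assumes "w permutes {..<n}"
  shows "\<exists>u. set u \<subseteq> {1..<n} \<and> word_perm u = w \<and> length u = len w"
  using assms
proof (induction "len w" arbitrary: w rule: less_induct)
  case less
  show ?case
  proof (cases "\<exists>i. Suc i < n \<and> inv w (Suc i) < inv w i")
    case False
    then have "inv w i < inv w (Suc i)" if "Suc i < n" for i
      using that permutes_Suc_neq[OF permutes_inv[OF less.prems], of i] by (meson nat_neq_iff)
    then have "inv w = id" by (intro ascending_permutes_id[OF permutes_inv[OF less.prems]])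
    then have "w = id" using permutes_inv_inv[OF less.prems] by (metis inv_id)
    then show ?thesis by (intro exI[of _ "[]"]) simp
  next
    case True
    then obtain i where i: "Suc i < n" "inv w (Suc i) < inv w i" by auto
    then have l: "Suc (len (adj i \<circ> w)) = len w" by (intro len_adj_comp_less[OF less.prems])
    have "(adj i \<circ> w) permutes {..<n}" by (rule permutes_compose[OF less.prems adj_permutes[OF i(1)]])
    then obtain u where u: "set u \<subseteq> {1..<n}" "word_perm u = adj i \<circ> w" "length u = len (adj i \<circ> w)"
      using less.hyps[of "adj i \<circ> w"] l by auto
    have "word_perm (Suc i # u) = w" using u(2) by (simp add: adj_adj_comp)
    then show ?thesis using u l i(1) by (intro exI[of _ "Suc i # u"]) simp
  qed
qed

text \<open>Words do not mention the field, but the ideal does; the type argument fixes which field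
  is meant.\<close>

definition word_eqv :: "'k::field itself \<Rightarrow> nat \<Rightarrow> nat list \<Rightarrow> nat list \<Rightarrow> bool"
  where "word_eqv _ n u v \<longleftrightarrow> wterm u 1 - wterm v 1 \<in> (nilcoxeter_ideal n :: (nat free_word \<Rightarrow>\<^sub>0 'k) set)"

lemma word_eqv_sym: "word_eqv K n u v \<Longrightarrow> word_eqv K n v u"
  unfolding word_eqv_def by (metis minus_diff_eq nilcoxeter_ideal_closed(3))

lemma word_eqv_trans: "word_eqv K n u v \<Longrightarrow> word_eqv K n v w \<Longrightarrow> word_eqv K n u w"
  unfolding word_eqv_def
  using nilcoxeter_ideal_closed(2)[of "wterm u 1 - wterm v 1" n "wterm v 1 - wterm w 1"] by simp

lemma word_eqv_refl: "word_eqv K n u u"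
  by (simp add: word_eqv_def nilcoxeter_ideal_closed(1))

lemma word_eqv_append_left:
  assumes "word_eqv K n u v" "set a \<subseteq> {1..<n}"
  shows "word_eqv K n (a @ u) (a @ v)"
  using nilcoxeter_ideal_closed(4)[OF assms(1)[unfolded word_eqv_def] wterm_carrier[OF assms(2), of 1]]
  by (simp add: word_eqv_def right_diff_distrib wterm_mult)

lemma word_eqv_append_right:
  assumes "word_eqv K n u v" "set a \<subseteq> {1..<n}"
  shows "word_eqv K n (u @ a) (v @ a)"
  using nilcoxeter_ideal_closed(5)[OF assms(1)[unfolded word_eqv_def] wterm_carrier[OF assms(2), of 1]]
  by (simp add: word_eqv_def left_diff_distrib wterm_mult)

lemma word_eqv_braid:
  assumes "{i, i + 1} \<subseteq> {1..<n}"
  shows "word_eqv K n [i, i + 1, i] [i + 1, i, i + 1]"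
proof -
  have "gen i * gen (i + 1) * gen i - gen (i + 1) * gen i * gen (i + 1) \<in> nilcoxeter_relators n"
    using assms unfolding nilcoxeter_relators_def by auto
  then show ?thesis
    using nilcoxeter_relators_in_ideal by (auto simp: word_eqv_def gen_wterm wterm_mult)
qed

lemma word_eqv_commute:
  assumes "{i, j} \<subseteq> {1..<n}" "i + 1 < j"
  shows "word_eqv K n [i, j] [j, i]"
proof -
  have "gen i * gen j - gen j * gen i \<in> nilcoxeter_relators n"
    unfolding nilcoxeter_relators_def
    by (rule UnI1, rule UnI2, intro CollectI exI[of _ i] exI[of _ j] conjI refl) (use assms in auto)
  then show ?thesis
    using nilcoxeter_relators_in_ideal by (auto simp: word_eqv_def gen_wterm wterm_mult)
qed

lemma wterm_square_in_ideal:
  assumes "set (i # r) \<subseteq> {1..<n}"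
  shows "wterm (i # i # r) 1 \<in> nilcoxeter_ideal n"
proof -
  have "gen i * gen i \<in> nilcoxeter_relators n"
    using assms unfolding nilcoxeter_relators_def by auto
  then have "gen i * gen i \<in> nilcoxeter_ideal n"
    using nilcoxeter_relators_in_ideal by blast
  then have "gen i * gen i * wterm r 1 \<in> nilcoxeter_ideal n"
    using assms nilcoxeter_ideal_closed(5)[OF _ wterm_carrier[of r "{1..<n}" 1]] by auto
  then show ?thesis by (simp add: gen_wterm wterm_mult)
qed

lemma adj_braid: "adj a \<circ> (adj (Suc a) \<circ> (adj a \<circ> w)) = adj (Suc a) \<circ> (adj a \<circ> (adj (Suc a) \<circ> w))"
  by (auto simp: fun_eq_iff transpose_def)

lemma adj_commute: "Suc a < b \<Longrightarrow> adj a \<circ> (adj b \<circ> w) = adj b \<circ> (adj a \<circ> w)"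
  by (auto simp: fun_eq_iff transpose_def)

text \<open>
  The induction step of Matsumoto's theorem: two reduced words of \<open>w\<close> with different first letters
  are compared through reduced words of \<open>w\<close> that start with the two sides of the braid or
  commutation relation for these letters.
\<close>

lemma reduced_words_eqv_step:
  assumes IH: "\<And>u v. set u \<subseteq> {1..<n} \<Longrightarrow> set v \<subseteq> {1..<n} \<Longrightarrow> word_perm u = word_perm v \<Longrightarrow>
      length u = l \<Longrightarrow> length v = l \<Longrightarrow> len (word_perm u) = l \<Longrightarrow> word_eqv K n u v"
    and w: "w permutes {..<n}" "len w = Suc l" and ab: "a < b" "Suc b < n"
    and u: "set u \<subseteq> {1..<n}" "word_perm u = adj a \<circ> w" "length u = l" "len (word_perm u) = l"
    and v: "set v \<subseteq> {1..<n}" "word_perm v = adj b \<circ> w" "length v = l" "len (word_perm v) = l"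
  shows "word_eqv K n (Suc a # u) (Suc b # v)"
proof -
  let ?y = "inv w"
  have a: "Suc a < n" using ab by simp
  have bij: "bij w" using permutes_bij[OF w(1)] .
  have perm: "(adj c \<circ> z) permutes {..<n}" if "z permutes {..<n}" "Suc c < n" for z c
    using permutes_compose[OF that(1) adj_permutes[OF that(2)]] .
  have desc: "?y (Suc c) < ?y c" if "Suc c < n" "len (adj c \<circ> w) = l" for c
    using len_adj_comp[OF w(1) that(1)] that(2) w(2)
      permutes_Suc_neq[OF permutes_inv[OF w(1)], of c] by (metis nat_neq_iff Suc_n_not_le_n le_Suc_eq)
  have da: "?y (Suc a) < ?y a" using desc[OF a] u by simp
  have db: "?y (Suc b) < ?y b" using desc[OF ab(2)] v by simp
  define z1 where "z1 = adj a \<circ> w"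
  have z1: "z1 permutes {..<n}" "inv z1 = ?y \<circ> adj a" "len z1 = l"
    using perm[OF w(1) a] inv_adj_comp[OF bij] u by (simp_all add: z1_def)
  have pu: "word_perm u = z1" using u by (simp add: z1_def)
  define z2 where "z2 = adj b \<circ> z1"
  have z2: "z2 permutes {..<n}" "inv z2 = ?y \<circ> adj a \<circ> adj b"
    using perm[OF z1(1) ab(2)] inv_adj_comp[OF permutes_bij[OF z1(1)]] z1(2) by (simp_all add: z2_def)
  have sets: "set [Suc a] \<subseteq> {1..<n}" "set [Suc b] \<subseteq> {1..<n}" using ab by auto
  show ?thesis
  proof (cases "b = Suc a")
    case False
    then have far: "Suc a < b" using ab by simp
    \<comment> \<open>\<open>adj a\<close> moves neither \<open>b\<close> nor \<open>Suc b\<close>,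
      so the descent at \<open>b\<close> persists and both letters can be split off from
      \<open>w\<close>.\<close>
    have "inv z1 (Suc b) < inv z1 b" using db far by (simp add: z1(2) transpose_def)
    then have l2: "Suc (len z2) = l" using len_adj_comp_less[OF z1(1) ab(2)] z1(3) by (simp add: z2_def)
    obtain r where r: "set r \<subseteq> {1..<n}" "word_perm r = z2" "length r = len z2"
      using ex_reduced_word[OF z2(1)] by auto
    have e1: "word_perm (Suc b # r) = z1" using r(2) by (simp add: z2_def adj_adj_comp)
    have e2: "word_perm (Suc a # r) = adj b \<circ> w"
      using r(2) far by (simp add: z2_def z1_def adj_commute adj_adj_comp flip: adj_commute)
    have "word_eqv K n u (Suc b # r)"
      using u r l2 sets z1(3) pu e1 by (intro IH) auto
    then have s1: "word_eqv K n (Suc a # u) ([Suc a, Suc b] @ r)"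
      using word_eqv_append_left[of K n u "Suc b # r" "[Suc a]"] sets by simp
    have "word_eqv K n v (Suc a # r)"
      using v r l2 sets e2 by (intro IH) auto
    then have s2: "word_eqv K n (Suc b # v) ([Suc b, Suc a] @ r)"
      using word_eqv_append_left[of K n v "Suc a # r" "[Suc b]"] sets by simp
    have "word_eqv K n ([Suc a, Suc b] @ r) ([Suc b, Suc a] @ r)"
      using far sets by (intro word_eqv_append_right r(1) word_eqv_commute) auto
    then show ?thesis using s1 s2 by (meson word_eqv_sym word_eqv_trans)
  next
    case True
    \<comment> \<open>Here the inverse of \<open>w\<close> is decreasing on \<open>a\<close>,
      \<open>a + 1\<close>, \<open>a + 2\<close>, so all three letters of the braid word can be
      split off.\<close>
    have "inv z1 (Suc b) < inv z1 b" using da db True by (simp add: z1(2) transpose_def)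
    then have l2: "Suc (len z2) = l" using len_adj_comp_less[OF z1(1) ab(2)] z1(3) by (simp add: z2_def)
    define z3 where "z3 = adj a \<circ> z2"
    have z3: "z3 permutes {..<n}" using perm[OF z2(1) a] by (simp add: z3_def)
    have "inv z2 (Suc a) < inv z2 a" using da db True by (simp add: z2(2) transpose_def)
    then have l3: "Suc (len z3) = len z2" using len_adj_comp_less[OF z2(1) a] by (simp add: z3_def)
    obtain r where r: "set r \<subseteq> {1..<n}" "word_perm r = z3" "length r = len z3"
      using ex_reduced_word[OF z3] by auto
    have e1: "word_perm (Suc b # Suc a # r) = z1" using r(2) by (simp add: z3_def z2_def adj_adj_comp)
    have "z3 = adj b \<circ> (adj a \<circ> (adj b \<circ> w))"
      using adj_braid[of a w] True by (simp add: z3_def z2_def z1_def)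
    then have e2: "word_perm (Suc a # Suc b # r) = adj b \<circ> w"
      using r(2) by (simp add: adj_adj_comp)
    have "word_eqv K n u (Suc b # Suc a # r)"
      using u r l2 l3 sets z1(3) pu e1 by (intro IH) auto
    then have s1: "word_eqv K n (Suc a # u) ([Suc a, Suc b, Suc a] @ r)"
      using word_eqv_append_left[of K n u "Suc b # Suc a # r" "[Suc a]"] sets by simp
    have "word_eqv K n v (Suc a # Suc b # r)"
      using v r l2 l3 sets e2 by (intro IH) auto
    then have s2: "word_eqv K n (Suc b # v) ([Suc b, Suc a, Suc b] @ r)"
      using word_eqv_append_left[of K n v "Suc a # Suc b # r" "[Suc b]"] sets by simp
    have "word_eqv K n ([Suc a, Suc b, Suc a] @ r) ([Suc b, Suc a, Suc b] @ r)"
      using word_eqv_braid[of "Suc a" n K] True sets by (intro word_eqv_append_right r(1)) auto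
    then show ?thesis using s1 s2 by (meson word_eqv_sym word_eqv_trans)
  qed
qed

text \<open>Matsumoto's theorem modulo the ideal, by induction on the length: equal first letters
  are cancelled, and different ones are the case treated before.\<close>

lemma reduced_words_eqv:
  assumes "set u \<subseteq> {1..<n}" "set v \<subseteq> {1..<n}" "word_perm u = word_perm v"
    "length u = l" "length v = l" "len (word_perm u) = l"
  shows "word_eqv K n u v"
  using assms
proof (induction l arbitrary: u v)
  case 0
  then show ?case by (simp add: word_eqv_refl)
next
  case (Suc l)
  obtain i u' j v' where u: "u = i # u'" and v: "v = j # v'"
    using Suc.prems(4,5) by (cases u; cases v) auto
  obtain a b where ab: "i = Suc a" "j = Suc b" "Suc a < n" "Suc b < n"
    using Suc.prems(1,2) u v by (cases i; cases j) auto
  let ?w = "word_perm u"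
  have w: "?w permutes {..<n}" "len ?w = Suc l" using Suc.prems word_perm_permutes by auto
  have tail: "set t \<subseteq> {1..<n}" "word_perm t = adj c \<circ> ?w" "length t = l" "len (word_perm t) = l"
    if "set (Suc c # t) \<subseteq> {1..<n}" "word_perm (Suc c # t) = ?w" "length (Suc c # t) = Suc l" for c t
  proof -
    show t: "set t \<subseteq> {1..<n}" "length t = l" using that by auto
    show e: "word_perm t = adj c \<circ> ?w" unfolding that(2)[symmetric] by (simp add: adj_adj_comp)
    have "len (word_perm t) \<le> l" using len_word_perm[OF t(1)] t(2) by simp
    moreover have "len (adj c \<circ> ?w) = Suc (len ?w) \<or> Suc (len (adj c \<circ> ?w)) = len ?w"
      using that(1) by (intro len_adj_comp_cases[OF w(1)]) auto
    ultimately show "len (word_perm t) = l" using e w(2) by auto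
  qed
  note tu = tail[of a u'] and tv = tail[of b v']
  have pu: "set (Suc a # u') \<subseteq> {1..<n}" "word_perm (Suc a # u') = ?w" "length (Suc a # u') = Suc l"
    using Suc.prems u ab by auto
  have pv: "set (Suc b # v') \<subseteq> {1..<n}" "word_perm (Suc b # v') = ?w" "length (Suc b # v') = Suc l"
    using Suc.prems v ab by auto
  note tu = tu[OF pu] and tv = tv[OF pv]
  consider "a = b" | "a < b" | "b < a" by linarith
  then show ?case
  proof cases
    case 1
    then have "word_eqv K n u' v'" 
      using tu(2) tv(2) by (intro Suc.IH tu(1,3,4) tv(1,3)) simp
    then show ?thesis
      using word_eqv_append_left[of K n u' v' "[Suc a]"] 1 ab by (simp add: u v)
  next
    case 2
    then show ?thesis
      unfolding u v ab using tu tv ab by (intro reduced_words_eqv_step[OF Suc.IH w]) auto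
  next
    case 3
    then show ?thesis
      unfolding u v ab using tu tv ab by (intro word_eqv_sym[OF reduced_words_eqv_step[OF Suc.IH w]]) auto
  qed
qed

text \<open>At the first letter \<open>i\<close>, from the right, that makes the word non-reduced,
  the suffix \<open>u\<close> is reduced and \<open>adj (i - 1)\<close> shortens its permutation. So
  \<open>u\<close> is equivalent to a word that starts with \<open>i\<close>, and the square of a
  generator appears.\<close>

lemma nonreduced_word_in_ideal:
  assumes "set u \<subseteq> {1..<n}" "len (word_perm u) < length u"
  shows "wterm u 1 \<in> (nilcoxeter_ideal n :: (nat free_word \<Rightarrow>\<^sub>0 'k::field) set)"
  using assms
proof (induction u)
  case (Cons i u)
  then have u: "set u \<subseteq> {1..<n}" "set [i] \<subseteq> {1..<n}" by auto
  obtain a where a: "i = Suc a" "Suc a < n" using Cons.prems by (cases i) auto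
  have iu: "wterm [i] 1 * wterm u 1 = (wterm (i # u) 1 :: nat free_word \<Rightarrow>\<^sub>0 'k)"
    by (simp add: wterm_mult)
  show ?case
  proof (cases "len (word_perm u) < length u")
    case True
    then show ?thesis
      using nilcoxeter_ideal_closed(4)[OF Cons.IH[OF u(1)] wterm_carrier[OF u(2)]] iu by metis
  next
    case False
    let ?w = "word_perm u"
    have w: "?w permutes {..<n}" by (rule word_perm_permutes[OF u(1)])
    have lw: "len ?w = length u" using False len_word_perm[OF u(1)] by simp
    moreover have "len (adj a \<circ> ?w) < Suc (length u)"
      using Cons.prems(2) unfolding a word_perm_simps by (simp only: diff_Suc_1 length_Cons)
    ultimately have lx: "Suc (len (adj a \<circ> ?w)) = len ?w"
      using len_adj_comp_cases[OF w a(2)] by linarith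
    obtain r where r: "set r \<subseteq> {1..<n}" "word_perm r = adj a \<circ> ?w" "length r = len (adj a \<circ> ?w)"
      using ex_reduced_word[OF permutes_compose[OF w adj_permutes[OF a(2)]]] by auto
    have "word_eqv (TYPE('k)) n u (i # r)"
      using u r a lx lw by (intro reduced_words_eqv[where l = "length u"]) (auto simp: adj_adj_comp)
    then have "word_eqv (TYPE('k)) n (i # u) (i # i # r)"
      using word_eqv_append_left[of "TYPE('k)" n u "i # r" "[i]"] u by simp
    moreover have "wterm (i # i # r) 1 \<in> (nilcoxeter_ideal n :: (nat free_word \<Rightarrow>\<^sub>0 'k) set)"
      using u r by (intro wterm_square_in_ideal) auto
    ultimately show ?thesis
      unfolding word_eqv_def
      using nilcoxeter_ideal_closed(2)[of "wterm (i # u) 1 - wterm (i # i # r) 1" n "wterm (i # i # r) 1"]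
      by simp
  qed
qed simp

text \<open>The coefficient of \<open>T\<^sub>w\<close>: only reduced words of \<open>w\<close> count.\<close>

definition red_coeff :: "(nat \<Rightarrow> nat) \<Rightarrow> (nat free_word \<Rightarrow>\<^sub>0 'k::field) \<Rightarrow> 'k"
  where "red_coeff w f = (\<Sum>u\<in>Poly_Mapping.keys f.
    if word_perm (letters u) = w \<and> length (letters u) = len w then Poly_Mapping.lookup f u else 0)"

lemma red_coeff_superset:
  assumes "finite S" "Poly_Mapping.keys f \<subseteq> S"
  shows "red_coeff w f = (\<Sum>u\<in>S.
    if word_perm (letters u) = w \<and> length (letters u) = len w then Poly_Mapping.lookup f u else 0)"
  unfolding red_coeff_def using assms by (intro sum.mono_neutral_left) (auto simp: in_keys_iff)

lemma red_coeff_zero [simp]: "red_coeff w 0 = 0"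
  by (simp add: red_coeff_def)

lemma red_coeff_add: "red_coeff w (f + g) = red_coeff w f + red_coeff w g"
proof -
  let ?S = "Poly_Mapping.keys f \<union> Poly_Mapping.keys g"
  have "Poly_Mapping.keys (f + g) \<subseteq> ?S" by (rule keys_add)
  then show ?thesis
    by (simp add: red_coeff_superset[of ?S] flip: sum.distrib) (rule sum.cong, auto simp: lookup_add)
qed

lemma red_coeff_diff: "red_coeff w (f - g) = red_coeff w f - red_coeff w g"
  using red_coeff_add[of w "f - g" g] by simp

lemma red_coeff_sum: "red_coeff w (sum f S) = (\<Sum>a\<in>S. red_coeff w (f a))"
  by (induction S rule: infinite_finite_induct) (simp_all add: red_coeff_add)

lemma red_coeff_wterm: "red_coeff w (wterm u c) = (if word_perm u = w \<and> length u = len w then c else 0)"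
  using red_coeff_superset[of "{Word u}" "wterm u c" w] by (simp add: wterm_def)

lemma red_coeff_sandwich_zero:
  assumes x: "x \<in> carrier (nc_free n)" and y: "y \<in> carrier (nc_free n)"
    and r: "\<And>u v c d. set u \<subseteq> {1..<n} \<Longrightarrow> set v \<subseteq> {1..<n} \<Longrightarrow> red_coeff w (wterm u c * r * wterm v d) = 0"
  shows "red_coeff w (x * r * y) = 0"
  using x
proof (induction rule: free_algebra_induct)
  case (wterm u c)
  show ?case
    using y
  proof (induction rule: free_algebra_induct)
    case (wterm v d)
    then show ?case using r \<open>set u \<subseteq> {1..<n}\<close> by blast
  qed (simp_all add: distrib_left red_coeff_add)
qed (simp_all add: distrib_right red_coeff_add)

text \<open>This is the linear independence of the \<open>T_w\<close>. The two sides of a braid or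
  commutation relator have equal length and equal permutation, so they are counted alike in any
  context; a square makes every word containing it non-reduced.\<close>

lemma red_coeff_ideal:
  fixes f :: "nat free_word \<Rightarrow>\<^sub>0 'k::field"
  assumes "f \<in> nilcoxeter_ideal n"
  shows "red_coeff w f = 0"
proof -
  let ?A = "nc_free n :: (nat free_word \<Rightarrow>\<^sub>0 'k) ring"
  \<comment> \<open>The kernel of the single functional \<open>red_coeff w\<close> need not be an
    ideal; \<open>?J\<close> is the largest ideal inside it.\<close>
  let ?J = "{f \<in> carrier ?A. \<forall>x\<in>carrier ?A. \<forall>y\<in>carrier ?A. red_coeff w (x * f * y) = 0}"
  interpret A: ring ?A by (rule free_algebra_ring)
  have ops: "0 \<in> carrier ?A" "1 \<in> carrier ?A" using A.zero_closed A.one_closed by (simp_all add: free_algebra_def)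
  have minus: "\<ominus>\<^bsub>?A\<^esub> x = - x" if "x \<in> carrier ?A" for x
    using that by (intro A.minus_equality) (auto simp: free_algebra_def)
  have "ideal ?J ?A"
  proof (rule idealI)
    show "subgroup ?J (add_monoid ?A)"
    proof (rule A.add.subgroupI)
      show "?J \<noteq> {}" using ops by (auto intro!: exI[of _ 0])
      fix a assume a: "a \<in> ?J"
      have "red_coeff w (x * - a * y) = 0" if "x \<in> carrier ?A" "y \<in> carrier ?A" for x y
        using a that red_coeff_diff[of w 0 "x * a * y"] by simp
      then show "\<ominus>\<^bsub>?A\<^esub> a \<in> ?J"
        using a A.a_inv_closed[of a] minus[of a] by auto
      fix b assume b: "b \<in> ?J"
      show "a \<oplus>\<^bsub>?A\<^esub> b \<in> ?J"
        using a b A.a_closed[of a b] by (auto simp: free_algebra_def distrib_left distrib_right red_coeff_add)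
    qed auto
  next
    fix a x assume a: "a \<in> ?J" and x: "x \<in> carrier ?A"
    have "red_coeff w (y * (x * a) * z) = 0 \<and> red_coeff w (y * (a * x) * z) = 0"
      if yz: "y \<in> carrier ?A" "z \<in> carrier ?A" for y z
    proof -
      have "y * x \<in> carrier ?A" "x * z \<in> carrier ?A" using x yz by (auto intro: free_algebra_closed)
      then have "red_coeff w ((y * x) * a * z) = 0" "red_coeff w (y * a * (x * z)) = 0" using a yz by auto
      then show ?thesis by (simp add: mult.assoc)
    qed
    then show "x \<otimes>\<^bsub>?A\<^esub> a \<in> ?J" "a \<otimes>\<^bsub>?A\<^esub> x \<in> ?J"
      using a x A.m_closed[of a x] A.m_closed[of x a] by (auto simp: free_algebra_def)
  qed (rule A.ring_axioms)
  moreover have "nilcoxeter_relators n \<subseteq> ?J"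
  proof
    fix r :: "nat free_word \<Rightarrow>\<^sub>0 'k" assume r: "r \<in> nilcoxeter_relators n"
    have "red_coeff w (wterm u c * r * wterm v d) = 0" if uv: "set u \<subseteq> {1..<n}" "set v \<subseteq> {1..<n}" for u v c d
    proof -
      have eq: "red_coeff w (wterm u c * (wterm a 1 - wterm b 1) * wterm v d) = 0"
        if "word_perm a = word_perm b" "length a = length b" for a b
        using that by (simp add: right_diff_distrib left_diff_distrib wterm_mult red_coeff_diff red_coeff_wterm)
      from r consider i where "i \<ge> 1" "r = wterm [i, i + 1, i] 1 - wterm [i + 1, i, i + 1] 1"
        | i j where "i \<ge> 1" "j \<ge> 1" "\<bar>int i - int j\<bar> > 1" "r = wterm [i, j] 1 - wterm [j, i] 1"
        | i where "i \<in> {1..<n}" "r = wterm [i, i] 1"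
        unfolding nilcoxeter_relators_def gen_wterm wterm_mult by auto
      then show ?thesis
      proof cases
        case (1 i)
        have "word_perm [i, i + 1, i] = word_perm [i + 1, i, i + 1]"
          using adj_braid[of "i - 1" id] 1(1) by simp
        then show ?thesis unfolding 1 by (intro eq) simp_all
      next
        case (2 i j)
        have "word_perm [i, j] = word_perm [j, i]"
          using adj_commute[of "i - 1" "j - 1" id] adj_commute[of "j - 1" "i - 1" id] 2(1-3)
          by (cases "i < j") auto
        then show ?thesis unfolding 2 by (intro eq) simp_all
      next
        case (3 i)
        \<comment> \<open>Without the square the word has the same permutation and two letters
          fewer, so \<open>u @ [i, i] @ v\<close> is not reduced.\<close>
        have "len (word_perm (u @ v)) \<le> length (u @ v)" using uv by (intro len_word_perm) auto
        moreover have "word_perm (u @ [i, i] @ v) = word_perm (u @ v)"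
          by (simp add: comp_assoc adj_adj_comp)
        ultimately show ?thesis unfolding 3 wterm_mult red_coeff_wterm by auto
      qed
    qed
    then have "red_coeff w (x * r * y) = 0" if "x \<in> carrier ?A" "y \<in> carrier ?A" for x y
      by (intro red_coeff_sandwich_zero[OF that])
    then show "r \<in> ?J" using r nilcoxeter_relators_closed by blast
  qed
  ultimately have "nilcoxeter_ideal n \<subseteq> ?J"
    unfolding nilcoxeter_ideal_def by (rule A.genideal_minimal)
  then have "red_coeff w (1 * f * 1) = 0" using assms ops by blast
  then show ?thesis by simp
qed

section \<open>Expansion in the basis\<close>

definition reduced_word :: "nat \<Rightarrow> (nat \<Rightarrow> nat) \<Rightarrow> nat list"
  where "reduced_word n w = (SOME u. set u \<subseteq> {1..<n} \<and> word_perm u = w \<and> length u = len w)"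

lemma reduced_word:
  assumes "w permutes {..<n}"
  shows "set (reduced_word n w) \<subseteq> {1..<n}" "word_perm (reduced_word n w) = w"
    "length (reduced_word n w) = len w"
  using someI_ex[OF ex_reduced_word[OF assms]] by (simp_all add: reduced_word_def)

definition expand :: "nat \<Rightarrow> ((nat \<Rightarrow> nat) \<Rightarrow> 'k::field) \<Rightarrow> nat free_word \<Rightarrow>\<^sub>0 'k"
  where "expand n c = (\<Sum>w | w permutes {..<n}. wterm (reduced_word n w) (c w))"

lemma finite_perms: "finite {w. w permutes {..<n::nat}}"
  by (simp add: finite_permutations)

lemma expand_carrier: "expand n c \<in> carrier (nc_free n)"
  unfolding expand_def by (intro free_algebra_sum_closed wterm_carrier) (rule reduced_word(1), simp)

lemma expand_add: "expand n c + expand n d = expand n (\<lambda>w. c w + d w)"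
  by (simp add: expand_def sum.distrib flip: wterm_add)

lemma red_coeff_expand:
  assumes "w permutes {..<n}"
  shows "red_coeff w (expand n c) = c w"
proof -
  have "red_coeff w (expand n c) = (\<Sum>v | v permutes {..<n}. if v = w then c w else 0)"
    unfolding expand_def red_coeff_sum red_coeff_wterm
    by (intro sum.cong) (auto simp: reduced_word)
  then show ?thesis using assms by (simp add: finite_perms)
qed

text \<open>The \<open>T_w\<close> span: modulo the ideal, a monomial is a multiple of the chosen
  reduced word of its permutation if it is reduced, and zero otherwise.\<close>

lemma diff_expand_in_ideal:
  fixes f :: "nat free_word \<Rightarrow>\<^sub>0 'k::field"
  assumes "f \<in> carrier (nc_free n)"
  shows "f - expand n (\<lambda>w. red_coeff w f) \<in> nilcoxeter_ideal n"
  using assms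
proof (induction rule: free_algebra_induct)
  case zero
  then show ?case by (simp add: expand_def nilcoxeter_ideal_closed)
next
  case (add f g)
  have eq: "f + g - expand n (\<lambda>w. red_coeff w (f + g)) =
    (f - expand n (\<lambda>w. red_coeff w f)) + (g - expand n (\<lambda>w. red_coeff w g))"
    by (simp add: red_coeff_add flip: expand_add)
  show ?case unfolding eq by (rule nilcoxeter_ideal_closed(2)[OF add])
next
  case (wterm u c)
  let ?w = "word_perm u"
  have w: "?w permutes {..<n}" by (rule word_perm_permutes[OF wterm])
  have scal: "wterm [] c \<in> carrier (nc_free n)" by (simp add: wterm_carrier)
  show ?case
  proof (cases "length u = len ?w")
    case True
    have "expand n (\<lambda>w. red_coeff w (wterm u c)) =
      (\<Sum>w | w permutes {..<n}. if w = ?w then wterm (reduced_word n ?w) c else 0)"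
      unfolding expand_def red_coeff_wterm using True by (intro sum.cong) auto
    also have "\<dots> = wterm (reduced_word n ?w) c" using w by (simp add: finite_perms)
    finally have e: "wterm u c - expand n (\<lambda>w. red_coeff w (wterm u c)) =
      wterm [] c * (wterm u 1 - wterm (reduced_word n ?w) 1)"
      by (simp add: right_diff_distrib wterm_scale)
    have "word_eqv TYPE('k) n u (reduced_word n ?w)"
      using wterm True reduced_word[OF w] by (intro reduced_words_eqv[where l = "length u"]) auto
    then show ?thesis
      unfolding e word_eqv_def by (intro nilcoxeter_ideal_closed(4) scal)
  next
    case False
    then have "len ?w < length u" using len_word_perm[OF wterm] by simp
    then have "wterm [] c * wterm u 1 \<in> nilcoxeter_ideal n"
      by (intro nilcoxeter_ideal_closed(4) nonreduced_word_in_ideal wterm scal)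
    moreover have "red_coeff w (wterm u c) = 0" for w
      using False by (auto simp: red_coeff_wterm)
    ultimately show ?thesis by (simp add: expand_def wterm_scale)
  qed
qed

lemma in_ideal_iff:
  assumes "f \<in> carrier (nc_free n)"
  shows "f \<in> nilcoxeter_ideal n \<longleftrightarrow> (\<forall>w. w permutes {..<n} \<longrightarrow> red_coeff w f = 0)"
proof
  assume "\<forall>w. w permutes {..<n} \<longrightarrow> red_coeff w f = 0"
  then have "expand n (\<lambda>w. red_coeff w f) = 0" by (simp add: expand_def)
  then show "f \<in> nilcoxeter_ideal n" using diff_expand_in_ideal[OF assms] by simp
qed (simp add: red_coeff_ideal)

section \<open>The center\<close>

text \<open>A word followed by the letter \<open>Suc a\<close> is a reduced word of \<open>w\<close>
  exactly if the word itself is a reduced word of \<open>w \<circ> adj a\<close> and this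
  permutation is shorter than \<open>w\<close>.\<close>

lemma red_coeff_mult_right:
  assumes f: "f \<in> carrier (nc_free n)" and w: "w permutes {..<n}" and a: "Suc a < n"
  shows "red_coeff w (f * wterm [Suc a] 1) =
    (if len (w \<circ> adj a) < len w then red_coeff (w \<circ> adj a) f else 0)"
  using f
proof (induction rule: free_algebra_induct)
  case (wterm u c)
  have "word_perm u \<circ> adj a = w \<longleftrightarrow> word_perm u = w \<circ> adj a"
    by (auto simp: fun_eq_iff) (metis transpose_involutory)+
  then show ?case
    using len_word_perm[OF wterm] len_comp_adj_cases[OF w a]
    by (auto simp: wterm_mult red_coeff_wterm)
next
  case (add f g)
  then show ?case
    by (cases "len (w \<circ> adj a) < len w") (simp_all only: distrib_right red_coeff_add if_True if_False add_0)
qed simp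

lemma red_coeff_mult_left:
  assumes f: "f \<in> carrier (nc_free n)" and w: "w permutes {..<n}" and a: "Suc a < n"
  shows "red_coeff w (wterm [Suc a] 1 * f) =
    (if len (adj a \<circ> w) < len w then red_coeff (adj a \<circ> w) f else 0)"
  using f
proof (induction rule: free_algebra_induct)
  case (wterm u c)
  have "adj a \<circ> word_perm u = w \<longleftrightarrow> word_perm u = adj a \<circ> w"
    using adj_adj_comp by metis
  then show ?case
    using len_word_perm[OF wterm] len_adj_comp_cases[OF w a]
    by (auto simp: wterm_mult red_coeff_wterm)
next
  case (add f g)
  then show ?case
    by (cases "len (adj a \<circ> w) < len w") (simp_all only: distrib_left red_coeff_add if_True if_False add_0)
qed simp

lemma wterm_Nil_commute:
  "f \<in> carrier (nc_free n) \<Longrightarrow> f * wterm [] c = wterm [] c * f"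
  by (induction rule: free_algebra_induct)
    (simp_all add: distrib_left distrib_right wterm_mult mult.commute)

text \<open>The commutator with \<open>f\<close> satisfies the Leibniz rule, so by induction on
  words it lies in the ideal as soon as it does on the generators.\<close>

lemma commutes_with_generators:
  fixes f :: "nat free_word \<Rightarrow>\<^sub>0 'k::field"
  assumes f: "f \<in> carrier (nc_free n)"
    and gens: "\<And>a. Suc a < n \<Longrightarrow> f * wterm [Suc a] 1 - wterm [Suc a] 1 * f \<in> nilcoxeter_ideal n"
    and g: "g \<in> carrier (nc_free n)"
  shows "f * g - g * f \<in> nilcoxeter_ideal n"
  using g
proof (induction rule: free_algebra_induct)
  case zero
  then show ?case by (simp add: nilcoxeter_ideal_closed)
next
  case (add g h)
  have eq: "f * (g + h) - (g + h) * f = (f * g - g * f) + (f * h - h * f)"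
    by (simp add: algebra_simps)
  show ?case unfolding eq by (rule nilcoxeter_ideal_closed(2)[OF add])
next
  case (wterm u c)
  then show ?case
  proof (induction u)
    case Nil
    then show ?case using wterm_Nil_commute[OF f] by (simp add: nilcoxeter_ideal_closed)
  next
    case (Cons i u)
    obtain a where a: "i = Suc a" "Suc a < n" using Cons.prems by (cases i) auto
    let ?m = "wterm [i] 1 :: nat free_word \<Rightarrow>\<^sub>0 'k" and ?t = "wterm u c :: nat free_word \<Rightarrow>\<^sub>0 'k"
    have eq: "f * wterm (i # u) c - wterm (i # u) c * f = (f * ?m - ?m * f) * ?t + ?m * (f * ?t - ?t * f)"
      using wterm_mult[of "[i]" "1 :: 'k" u c] by (simp add: left_diff_distrib right_diff_distrib mult.assoc)
        (simp flip: mult.assoc)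
    have "f * ?m - ?m * f \<in> nilcoxeter_ideal n" using gens a by simp
    moreover have "f * ?t - ?t * f \<in> nilcoxeter_ideal n" using Cons by simp
    moreover have "?m \<in> carrier (nc_free n)" "?t \<in> carrier (nc_free n)"
      using Cons.prems by (auto intro: wterm_carrier)
    ultimately show ?case unfolding eq by (intro nilcoxeter_ideal_closed(2,4,5))
  qed
qed

text \<open>The coefficient equation at \<open>w\<close> compares \<open>w \<circ> adj a\<close>
  with \<open>adj a \<circ> w\<close>, which are conjugate under \<open>adj a\<close>. Whichever of
  the two is shorter than \<open>w\<close> has a step to the other: if both are, the coefficients
  agree, and if only one is, its coefficient is 0.\<close>

lemma central_coeffs_iff:
  "central_coeffs n c \<longleftrightarrow> (\<forall>a w. Suc a < n \<longrightarrow> w permutes {..<n} \<longrightarrow>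
    (if len (w \<circ> adj a) < len w then c (w \<circ> adj a) else 0) =
    (if len (adj a \<circ> w) < len w then c (adj a \<circ> w) else 0))"
  (is "_ \<longleftrightarrow> (\<forall>a w. Suc a < n \<longrightarrow> w permutes {..<n} \<longrightarrow> ?eq a w)")
proof (intro iffI allI impI)
  fix a w assume c: "central_coeffs n c" and a: "Suc a < n" and w: "w permutes {..<n}"
  let ?r = "w \<circ> adj a" and ?l = "adj a \<circ> w"
  have perm: "?r permutes {..<n}" "?l permutes {..<n}"
    using permutes_compose[OF adj_permutes[OF a] w] permutes_compose[OF w adj_permutes[OF a]] .
  have rw: "?r \<circ> adj a = w" "adj a \<circ> ?l = w" by (simp_all add: comp_assoc adj_adj_comp)
  have lr: "adj a \<circ> ?r \<circ> adj a = ?l" "adj a \<circ> ?l \<circ> adj a = ?r"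
    by (simp_all add: comp_assoc adj_adj_comp)
  have right: "conj_step n ?r ?l" if "len ?r < len w"
  proof -
    have "?r a < ?r (Suc a)"
      using len_comp_adj_less[OF perm(1) a] that permutes_Suc_neq[OF perm(1), of a] rw(1)
      by (metis Suc_lessD less_not_sym lessI nat_neq_iff)
    then show ?thesis using a perm(1) lr(1) unfolding conj_step_def by metis
  qed
  have left: "conj_step n ?l ?r" if "len ?l < len w"
  proof -
    have "inv ?l a < inv ?l (Suc a)"
      using len_adj_comp_less[OF perm(2) a] that permutes_Suc_neq[OF permutes_inv[OF perm(2)], of a] rw(2)
      by (metis Suc_lessD less_not_sym lessI nat_neq_iff)
    then show ?thesis using a perm(2) lr(2) unfolding conj_step_def by metis
  qed
  have cr: "if len ?l = len ?r then c ?r = c ?l else c ?r = 0" if "len ?r < len w"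
    using c right[OF that] unfolding central_coeffs_def by blast
  have cl: "if len ?r = len ?l then c ?l = c ?r else c ?l = 0" if "len ?l < len w"
    using c left[OF that] unfolding central_coeffs_def by blast
  show "?eq a w"
    using len_comp_adj_cases[OF w a] len_adj_comp_cases[OF w a] cr cl by (auto split: if_splits)
next
  assume eq: "\<forall>a w. Suc a < n \<longrightarrow> w permutes {..<n} \<longrightarrow> ?eq a w"
  show "central_coeffs n c"
    unfolding central_coeffs_def
  proof (intro allI impI)
    fix x y assume step: "conj_step n x y"
    then have x: "x permutes {..<n}" by (simp add: conj_step_def)
    from step show "if len y = len x then c x = c y else c x = 0"
    proof (cases rule: conj_step_cases)
      case (1 a)
      let ?w = "x \<circ> adj a"
      have w: "?w permutes {..<n}" by (rule permutes_compose[OF adj_permutes[OF 1(1)] x])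
      have e: "?w \<circ> adj a = x" "adj a \<circ> ?w = y" unfolding 1(2) by (simp_all add: comp_assoc)
      have "?eq a ?w" using eq 1(1) w by blast
      then show ?thesis
        using len_adj_comp_cases[OF w 1(1)] 1(3) unfolding e by (auto split: if_splits)
    next
      case (2 a)
      let ?w = "adj a \<circ> x"
      have w: "?w permutes {..<n}" by (rule permutes_compose[OF x adj_permutes[OF 2(1)]])
      have e: "?w \<circ> adj a = y" "adj a \<circ> ?w = x" unfolding 2(2) by (simp_all add: adj_adj_comp)
      have "?eq a ?w" using eq 2(1) w by blast
      then show ?thesis
        using len_comp_adj_cases[OF w 2(1)] 2(3) unfolding e by (auto split: if_splits)
    qed
  qed
qed

lemma commutes_iff_central_coeffs:
  fixes f :: "nat free_word \<Rightarrow>\<^sub>0 'k::field"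
  assumes f: "f \<in> carrier (nc_free n)"
  shows "(\<forall>g\<in>carrier (nc_free n). f * g - g * f \<in> nilcoxeter_ideal n) \<longleftrightarrow>
    central_coeffs n (\<lambda>w. red_coeff w f)"
proof -
  let ?m = "\<lambda>a. wterm [Suc a] 1 :: nat free_word \<Rightarrow>\<^sub>0 'k"
  have m: "?m a \<in> carrier (nc_free n)" if "Suc a < n" for a
    using that by (intro wterm_carrier) auto
  have "(\<forall>g\<in>carrier (nc_free n). f * g - g * f \<in> nilcoxeter_ideal n) \<longleftrightarrow>
    (\<forall>a. Suc a < n \<longrightarrow> f * ?m a - ?m a * f \<in> nilcoxeter_ideal n)"
    using m commutes_with_generators[OF f] by blast
  also have "\<dots> \<longleftrightarrow> (\<forall>a w. Suc a < n \<longrightarrow> w permutes {..<n} \<longrightarrow>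
      red_coeff w (f * ?m a) = red_coeff w (?m a * f))"
    using m f by (auto simp: in_ideal_iff free_algebra_closed red_coeff_diff)
  also have "\<dots> \<longleftrightarrow> central_coeffs n (\<lambda>w. red_coeff w f)"
    unfolding central_coeffs_iff by (auto simp: red_coeff_mult_right[OF f] red_coeff_mult_left[OF f])
  finally show ?thesis .
qed

section \<open>Class sums and their combinations\<close>

definition class_sum :: "nat \<Rightarrow> nat list \<Rightarrow> nat free_word \<Rightarrow>\<^sub>0 'k::field"
  where "class_sum n ps = expand n (\<lambda>w. if w \<in> canon_class n ps then 1 else 0)"

text \<open>The index set is given as a list to match \<open>ring.combine\<close>, which pairs a
  list of scalars with a list of vectors.\<close>

definition class_comb :: "nat \<Rightarrow> (nat list \<Rightarrow> 'k) \<Rightarrow> nat list list \<Rightarrow> nat free_word \<Rightarrow>\<^sub>0 'k::field"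
  where "class_comb n g L = sum_list (map (\<lambda>ps. wterm [] (g ps) * class_sum n ps) L)"

lemma class_comb_carrier: "class_comb n g L \<in> carrier (nc_free n)"
proof (induction L)
  case Nil
  show ?case by (simp add: class_comb_def free_algebra_def)
next
  case (Cons ps L)
  have "wterm [] (g ps) * class_sum n ps \<in> carrier (nc_free n)"
    unfolding class_sum_def by (intro free_algebra_closed wterm_carrier expand_carrier) simp
  then show ?case
    using free_algebra_closed(1)[OF _ Cons] by (simp add: class_comb_def)
qed

lemma wterm_Nil_expand: "wterm [] a * expand n c = expand n (\<lambda>w. a * c w)"
  by (simp add: expand_def sum_distrib_left wterm_scale)

lemma red_coeff_class_comb:
  assumes "w permutes {..<n}" "distinct L"
  shows "red_coeff w (class_comb n g L) = (\<Sum>ps\<in>set L. if w \<in> canon_class n ps then g ps else 0)"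
  using assms(2)
proof (induction L)
  case Nil
  show ?case by (simp add: class_comb_def)
next
  case (Cons ps L)
  then show ?case
    by (simp add: class_comb_def class_sum_def wterm_Nil_expand red_coeff_add red_coeff_expand[OF assms(1)])
qed

text \<open>The classes are disjoint, so each canonical permutation lies only in its own class. The
  coefficients at canonical permutations are therefore coordinates, and the class sums are
  independent.\<close>

lemma red_coeff_class_comb_canon:
  assumes L: "set L = valid_lists n" "distinct L" and ps: "ps \<in> valid_lists n"
  shows "red_coeff (canon ps) (class_comb n g L) = g ps"
proof -
  have "canon ps \<in> canon_class n qs \<longleftrightarrow> qs = ps" if "qs \<in> valid_lists n" for qs
    using canon_class_disjoint[OF that ps _ canon_in_class] canon_in_class by blast
  then have "red_coeff (canon ps) (class_comb n g L) = (\<Sum>qs\<in>valid_lists n. if qs = ps then g ps else 0)"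
    unfolding red_coeff_class_comb[OF canon_permutes[OF ps] L(2)] L(1) by (intro sum.cong) auto
  then show ?thesis using ps finite_valid_lists by simp
qed

lemma central_coeffs_class_comb:
  assumes L: "set L = valid_lists n" "distinct L"
  shows "central_coeffs n (\<lambda>w. red_coeff w (class_comb n g L))"
  unfolding central_coeffs_def
proof (intro allI impI)
  fix x y assume step: "conj_step n x y"
  have x: "x permutes {..<n}" and y: "y permutes {..<n}"
    using step conj_step_permutes[OF step] by (auto simp: conj_step_def)
  have c: "if len y = len x then (if x \<in> canon_class n ps then g ps else 0) = (if y \<in> canon_class n ps then g ps else 0)
      else (if x \<in> canon_class n ps then g ps else 0) = 0" if "ps \<in> set L" for ps
    using central_coeffs_class[of ps n "g ps"] that step unfolding L central_coeffs_def by blast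
  show "if len y = len x then red_coeff x (class_comb n g L) = red_coeff y (class_comb n g L)
      else red_coeff x (class_comb n g L) = 0"
  proof (cases "len y = len x")
    case True
    then show ?thesis
      unfolding red_coeff_class_comb[OF x L(2)] red_coeff_class_comb[OF y L(2)]
      using c True by (auto intro: sum.cong)
  next
    case False
    then show ?thesis
      unfolding red_coeff_class_comb[OF x L(2)] using c False by (auto intro: sum.neutral)
  qed
qed

text \<open>Lets a list of scalars be treated as a function on the indices in
  \<open>L\<close>.\<close>

lemma ex_map_eq: "distinct L \<Longrightarrow> length cs = length L \<Longrightarrow> \<exists>g. cs = map g L"
proof (induction L arbitrary: cs)
  case (Cons p L)
  then obtain c cs' where cs: "cs = c # cs'" "length cs' = length L" by (cases cs) auto
  then obtain g where "cs' = map g L" using Cons by auto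
  then show ?case using cs Cons.prems by (intro exI[of _ "g(p := c)"]) auto
qed simp

section \<open>Passing to the quotient ring\<close>

definition nc_class :: "nat \<Rightarrow> (nat free_word \<Rightarrow>\<^sub>0 'k::field) \<Rightarrow> (nat free_word \<Rightarrow>\<^sub>0 'k) set"
  where "nc_class n f = nilcoxeter_ideal n +>\<^bsub>nc_free n\<^esub> f"

lemma nc_class_hom: "nc_class n \<in> ring_hom (nc_free n) (nilcoxeter n :: (nat free_word \<Rightarrow>\<^sub>0 'k::field) set ring)"
proof -
  interpret I: ideal "nilcoxeter_ideal n" "nc_free n :: (nat free_word \<Rightarrow>\<^sub>0 'k) ring"
    by (rule nilcoxeter_ideal_ideal)
  have "nc_class n = ((+>\<^bsub>nc_free n :: (nat free_word \<Rightarrow>\<^sub>0 'k) ring\<^esub>) (nilcoxeter_ideal n))"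
    by (simp add: fun_eq_iff nc_class_def)
  then show ?thesis using I.rcos_ring_hom unfolding nilcoxeter_def by simp
qed

lemma nc_class_mult:
  "f \<in> carrier (nc_free n) \<Longrightarrow> g \<in> carrier (nc_free n) \<Longrightarrow>
    nc_class n f \<otimes>\<^bsub>nilcoxeter n\<^esub> nc_class n g = nc_class n (f * g)"
  using ring_hom_mult[OF nc_class_hom, of f n g] by (simp add: free_algebra_def)

lemma nc_class_add:
  "f \<in> carrier (nc_free n) \<Longrightarrow> g \<in> carrier (nc_free n) \<Longrightarrow>
    nc_class n f \<oplus>\<^bsub>nilcoxeter n\<^esub> nc_class n g = nc_class n (f + g)"
  using ring_hom_add[OF nc_class_hom, of f n g] by (simp add: free_algebra_def)

lemma nc_class_zero: "nc_class n 0 = \<zero>\<^bsub>nilcoxeter n\<^esub>"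
  using ring_hom_zero[OF nc_class_hom free_algebra_ring nilcoxeter_ring] by (simp add: free_algebra_def)

lemma carrier_nilcoxeter: "carrier (nilcoxeter n) = nc_class n ` carrier (nc_free n)"
  by (auto simp: nilcoxeter_def FactRing_def A_RCOSETS_def' nc_class_def)

lemma nc_class_eq_iff:
  fixes f g :: "nat free_word \<Rightarrow>\<^sub>0 'k::field"
  assumes "f \<in> carrier (nc_free n)" "g \<in> carrier (nc_free n)"
  shows "nc_class n f = nc_class n g \<longleftrightarrow> f - g \<in> nilcoxeter_ideal n"
proof -
  let ?A = "nc_free n :: (nat free_word \<Rightarrow>\<^sub>0 'k) ring"
  interpret A: ring ?A by (rule free_algebra_ring)
  have "\<ominus>\<^bsub>?A\<^esub> g = - g"
    using assms(2) by (intro A.minus_equality) (auto simp: free_algebra_def)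
  then have "f \<ominus>\<^bsub>?A\<^esub> g = f - g" by (simp add: a_minus_def free_algebra_def)
  then show ?thesis
    using A.quotient_eq_iff_same_a_r_cos[OF nilcoxeter_ideal_ideal assms] by (simp add: nc_class_def)
qed

lemma nilcoxeter_scalars_eq: "nilcoxeter_scalars n = range (\<lambda>c. nc_class n (wterm [] c))"
  by (simp add: nilcoxeter_scalars_def nc_class_def wterm_def zero_free_word_def)

lemma nc_class_in_center_iff:
  fixes f :: "nat free_word \<Rightarrow>\<^sub>0 'k::field"
  assumes f: "f \<in> carrier (nc_free n)"
  shows "nc_class n f \<in> ring_center (nilcoxeter n) \<longleftrightarrow> central_coeffs n (\<lambda>w. red_coeff w f)"
proof -
  have "nc_class n f \<in> ring_center (nilcoxeter n) \<longleftrightarrow>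
    (\<forall>g\<in>carrier (nc_free n). nc_class n f \<otimes>\<^bsub>nilcoxeter n\<^esub> nc_class n g = nc_class n g \<otimes>\<^bsub>nilcoxeter n\<^esub> nc_class n f)"
    using f by (auto simp: ring_center_def carrier_nilcoxeter)
  also have "\<dots> \<longleftrightarrow> (\<forall>g\<in>carrier (nc_free n). f * g - g * f \<in> nilcoxeter_ideal n)"
    using f by (intro ball_cong refl) (simp add: nc_class_mult nc_class_eq_iff free_algebra_closed)
  finally show ?thesis using commutes_iff_central_coeffs[OF f] by simp
qed

lemma class_sum_carrier: "class_sum n ps \<in> carrier (nc_free n)"
  unfolding class_sum_def by (rule expand_carrier)

lemma combine_class_sums:
  "ring.combine (nilcoxeter n) (map (\<lambda>ps. nc_class n (wterm [] (g ps))) L) (map (\<lambda>ps. nc_class n (class_sum n ps)) L) =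
    nc_class n (class_comb n g L)"
proof (induction L)
  case Nil
  show ?case by (simp add: class_comb_def nc_class_zero ring.combine.simps[OF nilcoxeter_ring])
next
  case (Cons ps L)
  have c: "wterm [] (g ps) \<in> carrier (nc_free n)" "class_sum n ps \<in> carrier (nc_free n)"
    by (simp add: wterm_carrier, rule class_sum_carrier)
  then have m: "wterm [] (g ps) * class_sum n ps \<in> carrier (nc_free n)" by (rule free_algebra_closed)
  have "class_comb n g (ps # L) = wterm [] (g ps) * class_sum n ps + class_comb n g L"
    by (simp add: class_comb_def)
  then show ?case
    by (simp only: list.map ring.combine.simps[OF nilcoxeter_ring] Cons nc_class_mult[OF c]
        nc_class_add[OF m class_comb_carrier])
qed

lemma nilcoxeter_center_dimension:
  "ring.dimension (nilcoxeter n :: (nat free_word \<Rightarrow>\<^sub>0 'k::field) set ring) (card (valid_lists n))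
    (nilcoxeter_scalars n) (ring_center (nilcoxeter n))"
proof -
  let ?N = "nilcoxeter n :: (nat free_word \<Rightarrow>\<^sub>0 'k) set ring"
  let ?K = "nilcoxeter_scalars n :: (nat free_word \<Rightarrow>\<^sub>0 'k) set set"
  interpret N: ring ?N by (rule nilcoxeter_ring)
  interpret K: subfield ?K ?N by (rule nilcoxeter_scalars_subfield)
  obtain L where L: "set L = valid_lists n" "distinct L"
    using finite_distinct_list[OF finite_valid_lists] by blast
  let ?Us = "map (\<lambda>ps. nc_class n (class_sum n ps)) L :: (nat free_word \<Rightarrow>\<^sub>0 'k) set list"
  have Us: "set ?Us \<subseteq> carrier ?N"
    using class_sum_carrier unfolding carrier_nilcoxeter set_map by blast
  have scal: "\<exists>g. Ks = map (\<lambda>ps. nc_class n (wterm [] (g ps))) L" if Ks: "set Ks \<subseteq> ?K" "length Ks = length L" for Ks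
  proof -
    obtain h where h: "Ks = map h L" using ex_map_eq[OF L(2) Ks(2)] by blast
    then have "\<forall>ps\<in>set L. \<exists>c. h ps = nc_class n (wterm [] c)"
      using Ks(1) by (auto simp: nilcoxeter_scalars_eq)
    then obtain g where "\<forall>ps\<in>set L. h ps = nc_class n (wterm [] (g ps))" by metis
    then show ?thesis using h by auto
  qed
  have zero: "\<zero>\<^bsub>?N\<^esub> \<in> ?K"
    unfolding nilcoxeter_scalars_eq using nc_class_zero wterm_zero by (metis rangeI)
  have "N.independent ?K ?Us"
  proof (rule N.trivial_combine_imp_independent[OF nilcoxeter_scalars_subfield Us])
    fix Ks assume Ks: "set Ks \<subseteq> ?K" "N.combine Ks ?Us = \<zero>\<^bsub>?N\<^esub>"
    \<comment> \<open>\<open>Ks\<close> may be shorter or longer than \<open>L\<close>. Padding by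
      zeros and truncating gives exactly one scalar per class without changing the
      combination.\<close>
    let ?Z = "Ks @ replicate (length L) \<zero>\<^bsub>?N\<^esub>"
    have "set (take (length L) ?Z) \<subseteq> ?K"
      using Ks(1) zero by (auto dest!: in_set_takeD)
    moreover have "length (take (length L) ?Z) = length L" by simp
    ultimately obtain g where g: "take (length L) ?Z = map (\<lambda>ps. nc_class n (wterm [] (g ps))) L"
      using scal by metis
    have "N.combine (take (length ?Us) ?Z) ?Us = \<zero>\<^bsub>?N\<^esub>"
      unfolding N.combine_take N.combine_append_replicate[OF Us] by (rule Ks(2))
    then have "nc_class n (class_comb n g L) = \<zero>\<^bsub>?N\<^esub>"
      using g combine_class_sums[of n g L] by simp
    then have "class_comb n g L \<in> nilcoxeter_ideal n"
      using nc_class_eq_iff[OF class_comb_carrier nilcoxeter_ideal_closed(6)[OF nilcoxeter_ideal_closed(1)], of n g L]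
      by (simp add: nc_class_zero)
    then have "g ps = 0" if "ps \<in> set L" for ps
      using red_coeff_class_comb_canon[OF L, of ps g] that L(1) red_coeff_ideal by metis
    then have "set (take (length L) ?Z) \<subseteq> {\<zero>\<^bsub>?N\<^esub>}" unfolding g by (auto simp: nc_class_zero)
    moreover have "set (take (length L) Ks) \<subseteq> set (take (length L) ?Z)" by simp
    ultimately show "set (take (length ?Us) Ks) \<subseteq> {\<zero>\<^bsub>?N\<^esub>}" by simp
  qed
  moreover have "N.Span ?K ?Us = ring_center ?N"
  proof (intro equalityI subsetI)
    fix z assume "z \<in> N.Span ?K ?Us"
    then obtain Ks where Ks: "z = N.combine Ks ?Us" "length Ks = length ?Us" "set Ks \<subseteq> ?K"
      unfolding N.Span_eq_combine_set_length_version[OF nilcoxeter_scalars_subfield Us] by blast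
    then obtain g where "Ks = map (\<lambda>ps. nc_class n (wterm [] (g ps))) L" using scal[of Ks] by auto
    then have "z = nc_class n (class_comb n g L)" using Ks(1) combine_class_sums by metis
    then show "z \<in> ring_center ?N"
      using nc_class_in_center_iff[OF class_comb_carrier] central_coeffs_class_comb[OF L] by metis
  next
    fix z assume z: "z \<in> ring_center ?N"
    then obtain f where f: "f \<in> carrier (nc_free n)" "z = nc_class n f"
      by (auto simp: ring_center_def carrier_nilcoxeter)
    then have c: "central_coeffs n (\<lambda>w. red_coeff w f)" using z nc_class_in_center_iff by blast
    \<comment> \<open>The coordinates of a central element are its coefficients at the canonical
      permutations.\<close>
    let ?g = "\<lambda>ps. red_coeff (canon ps) f"
    have "red_coeff w f = red_coeff w (class_comb n ?g L)" if w: "w permutes {..<n}" for w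
      using central_coeffs_expand[OF c w] unfolding red_coeff_class_comb[OF w L(2)] L(1) .
    then have "f - class_comb n ?g L \<in> nilcoxeter_ideal n"
      using in_ideal_iff[OF free_algebra_closed(3)[OF f(1) class_comb_carrier]] by (simp add: red_coeff_diff)
    then have "z = nc_class n (class_comb n ?g L)"
      using f nc_class_eq_iff[OF f(1) class_comb_carrier] by blast
    also have "\<dots> = N.combine (map (\<lambda>ps. nc_class n (wterm [] (?g ps))) L) ?Us"
      by (rule combine_class_sums[symmetric])
    finally show "z \<in> N.Span ?K ?Us"
      unfolding N.Span_eq_combine_set[OF nilcoxeter_scalars_subfield Us]
      by (auto simp: nilcoxeter_scalars_eq intro!: exI[of _ "map (\<lambda>ps. nc_class n (wterm [] (?g ps))) L"])
  qed
  ultimately have "N.dimension (length ?Us) ?K (ring_center ?N)"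
    by (rule N.dimensionI[OF nilcoxeter_scalars_subfield])
  then show ?thesis using distinct_card[OF L(2)] by (simp add: L(1))
qed

theorem mainTheorem1:
  fixes n :: nat
  assumes "n \<ge> 1"
  shows "\<exists>d. ring.dimension (nilcoxeter n :: (nat free_word \<Rightarrow>\<^sub>0 'k::field) set ring) d
               (nilcoxeter_scalars n) (ring_center (nilcoxeter n)) \<and>
             rat_of_nat d =
               (\<Sum>p\<in>partitions n. fact (num_even_parts p) / rat_of_nat (even_mult_fact p))"
  using nilcoxeter_center_dimension card_valid_lists by blast

end
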